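(* Let $(R,\mathfrak{m},K)$ be a Noetherian local ring or a standard graded $K$-algebra, and let $I\subset R$ be a proper ideal, assumed to be graded if $R$ is standard graded. Let $(h_0,h_1,h_2,\ldots)$ be the $h$-vector of $F(I)$. Then $$\mu(I^2)=\ell(I)\,\mu(I)-\binom{\ell(I)}{2}+h_2.$$
   Context: Here $\mathfrak{m}$ is the (graded) maximal ideal of $R$ and $K=R/\mathfrak{m}$. $\mu(L)$ denotes the minimal number of generators of an ideal $L$ (graded if $R$ is standard graded). The fiber ring of $I$ is the standard graded $K$-algebra $F(I)=\bigoplus_{k\geq 0}I^k/\mathfrak{m}I^k$, and the analytic spread $\ell(I)$ is the Krull dimension of $F(I)$. The Hilbert series of $F(I)$ has the form $\sum_{k\geq0}\mu(I^k)t^k=Q(t)/(1-t)^{\ell(I)}$ with $Q(t)=\sum_{i\geq 0}h_it^i$ a polynomial with integer coefficients and $h_0=1$; $(h_0,h_1,\ldots)$ is called the $h$-vector of $F(I)$. *)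

theory Defs
  imports
    "HOL-Algebra.Ideal_Product"
    "HOL-Algebra.QuotRing"
    "HOL-Algebra.Ring_Divisibility"
    "HOL-Algebra.Generated_Rings"
    "HOL-Algebra.Embedded_Algebras"
    "HOL-Library.Extended_Nat"
    "HOL-Computational_Algebra.Polynomial_FPS"
begin

section \<open>Local rings and standard graded algebras\<close>

locale noetherian_local_ring = cring R + noetherian_ring R
  for R (structure) +
  fixes \<mm> :: "'a set"
  assumes maximal: "maximalideal \<mm> R"
    and maximal_unique: "\<And>M. maximalideal M R \<Longrightarrow> M = \<mm>"

text \<open>\<open>A i\<close> is the homogeneous component of degree \<open>i\<close>. The base field \<open>K\<close> is the component
  \<open>A 0\<close>, as is part of the notion of a standard graded \<open>K\<close>-algebra.\<close>

locale standard_graded_algebra = cring R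
  for R (structure) +
  fixes A :: "nat \<Rightarrow> 'a set"
  assumes component_subgroup: "additive_subgroup (A i) R"
    and component_mult: "\<lbrakk>x \<in> A i; y \<in> A j\<rbrakk> \<Longrightarrow> x \<otimes> y \<in> A (i + j)"
    and direct_sum: "x \<in> carrier R \<Longrightarrow>
      \<exists>!a. (\<forall>i. a i \<in> A i) \<and> finite {i. a i \<noteq> \<zero>} \<and> x = (\<Oplus>i\<in>{i. a i \<noteq> \<zero>}. a i)"
    and base_field: "subfield (A 0) R"
    and standard: "\<exists>S. finite S \<and> S \<subseteq> A 1 \<and> generate_ring R (A 0 \<union> S) = carrier R"

definition graded_maximal_ideal :: "('a, 'b) ring_scheme \<Rightarrow> (nat \<Rightarrow> 'a set) \<Rightarrow> 'a set" where
  "graded_maximal_ideal R A = genideal R (\<Union>i\<in>{1..}. A i)"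

definition graded_ideal :: "('a, 'b) ring_scheme \<Rightarrow> (nat \<Rightarrow> 'a set) \<Rightarrow> 'a set \<Rightarrow> bool" where
  "graded_ideal R A I \<longleftrightarrow> ideal I R \<and> I = genideal R (I \<inter> (\<Union>i. A i))"


section \<open>Powers and numbers of generators of ideals\<close>

abbreviation ideal_pow :: "('a, 'b) ring_scheme \<Rightarrow> 'a set \<Rightarrow> nat \<Rightarrow> 'a set" where
  "ideal_pow R I k \<equiv> I [^]\<^bsub>ideals_set R\<^esub> k"

text \<open>Only meaningful for finitely generated ideals.\<close>

definition min_num_gens :: "('a, 'b) ring_scheme \<Rightarrow> 'a set \<Rightarrow> nat" where
  "min_num_gens R L =
    (LEAST n. \<exists>S. S \<subseteq> carrier R \<and> finite S \<and> card S = n \<and> genideal R S = L)"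


section \<open>The fiber ring and the analytic spread\<close>

abbreviation fiber_modulus :: "('a, 'b) ring_scheme \<Rightarrow> 'a set \<Rightarrow> 'a set \<Rightarrow> nat \<Rightarrow> 'a set" where
  "fiber_modulus R \<mm> I k \<equiv> ideal_prod R \<mm> (ideal_pow R I k)"

text \<open>Elements of \<open>F(I)\<close> are the finitely supported families \<open>f\<close> with
  \<open>f k \<in> I\<^sup>k/\<mm>I\<^sup>k\<close>, the latter consisting of cosets inside \<open>R/\<mm>I\<^sup>k\<close>.
  The set \<open>rcoset_mult R (\<mm>I\<^sup>i\<^sup>+\<^sup>j) (\<mm>I\<^sup>i + a) (\<mm>I\<^sup>j + b)\<close> is the single coset
  \<open>\<mm>I\<^sup>i\<^sup>+\<^sup>j + ab\<close> for \<open>a \<in> I\<^sup>i\<close> and \<open>b \<in> I\<^sup>j\<close>, so that it is the product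
  of homogeneous elements of degrees \<open>i\<close> and \<open>j\<close>.\<close>

definition fiber_ring ::
    "('a, 'b) ring_scheme \<Rightarrow> 'a set \<Rightarrow> 'a set \<Rightarrow> (nat \<Rightarrow> 'a set) ring" where
  "fiber_ring R \<mm> I =
    \<lparr>carrier = {f. (\<forall>k. \<exists>a\<in>ideal_pow R I k. f k = fiber_modulus R \<mm> I k +>\<^bsub>R\<^esub> a)
                  \<and> finite {k. f k \<noteq> fiber_modulus R \<mm> I k}},
     monoid.mult = (\<lambda>f g k. finsum (R Quot fiber_modulus R \<mm> I k)
       (\<lambda>i. rcoset_mult R (fiber_modulus R \<mm> I k) (f i) (g (k - i))) {..k}),
     one = (\<lambda>k. if k = 0 then fiber_modulus R \<mm> I 0 +>\<^bsub>R\<^esub> \<one>\<^bsub>R\<^esub> else fiber_modulus R \<mm> I k),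
     zero = (\<lambda>k. fiber_modulus R \<mm> I k),
     add = (\<lambda>f g k. f k \<oplus>\<^bsub>R Quot fiber_modulus R \<mm> I k\<^esub> g k)\<rparr>"

definition fiber_component ::
    "('a, 'b) ring_scheme \<Rightarrow> 'a set \<Rightarrow> 'a set \<Rightarrow> nat \<Rightarrow> (nat \<Rightarrow> 'a set) set" where
  "fiber_component R \<mm> I k =
    {f \<in> carrier (fiber_ring R \<mm> I). \<forall>j. j \<noteq> k \<longrightarrow> f j = fiber_modulus R \<mm> I j}"

definition krull_dim :: "('a, 'b) ring_scheme \<Rightarrow> enat" where
  "krull_dim S = Sup {enat n | n. \<exists>P :: nat \<Rightarrow> 'a set.
     (\<forall>i\<le>n. primeideal (P i) S) \<and> (\<forall>i<n. P i \<subset> P (Suc i))}"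

text \<open>As \<open>F(I)\<close> is a finitely generated algebra over a field, its Krull dimension is finite.\<close>

definition analytic_spread :: "('a, 'b) ring_scheme \<Rightarrow> 'a set \<Rightarrow> 'a set \<Rightarrow> nat" where
  "analytic_spread R \<mm> I = the_enat (krull_dim (fiber_ring R \<mm> I))"


section \<open>Hilbert series and h-vector\<close>

text \<open>The component of degree \<open>0\<close> is \<open>R/\<mm>\<close>, viewed as a subfield of \<open>F(I)\<close>. By Nakayama's
  lemma the dimension below is the minimal number of generators of \<open>I\<^sup>k\<close>.\<close>

definition fiber_hilbert_function ::
    "('a, 'b) ring_scheme \<Rightarrow> 'a set \<Rightarrow> 'a set \<Rightarrow> nat \<Rightarrow> nat" where
  "fiber_hilbert_function R \<mm> I k =
    ring.dim (fiber_ring R \<mm> I) (fiber_component R \<mm> I 0) (fiber_component R \<mm> I k)"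

definition fiber_hilbert_series :: "('a, 'b) ring_scheme \<Rightarrow> 'a set \<Rightarrow> 'a set \<Rightarrow> int fps" where
  "fiber_hilbert_series R \<mm> I = Abs_fps (\<lambda>k. int (fiber_hilbert_function R \<mm> I k))"

text \<open>The numerator \<open>Q(t)\<close> of the Hilbert series \<open>Q(t)/(1 - t)\<^sup>\<ell>\<close>. It is taken as a power
  series, so that the definition does not rest on the Hilbert--Serre theorem, by which it is
  a polynomial.\<close>

definition h_vector :: "('a, 'b) ring_scheme \<Rightarrow> 'a set \<Rightarrow> 'a set \<Rightarrow> nat \<Rightarrow> int" where
  "h_vector R \<mm> I i =
    fps_nth (fiber_hilbert_series R \<mm> I * (1 - fps_X) ^ analytic_spread R \<mm> I) i"

lemma h_vector_eq_coeff:
  fixes Q :: "int poly"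
  assumes "Abs_fps (\<lambda>k. of_nat (fiber_hilbert_function R \<mm> I k)) =
    fps_of_poly (map_poly rat_of_int Q) / (1 - fps_X) ^ analytic_spread R \<mm> I"
  shows "h_vector R \<mm> I i = poly.coeff Q i"
proof -
  let ?l = "analytic_spread R \<mm> I"
  let ?H = "fiber_hilbert_series R \<mm> I"
  let ?q = "\<lambda>F. Abs_fps (\<lambda>n. rat_of_int (fps_nth F n))"
  have q_mult: "?q (F * G) = ?q F * ?q G" for F G
    by (rule fps_ext) (simp add: fps_mult_nth)
  have q_pow: "?q ((1 - fps_X) ^ n) = (1 - fps_X) ^ n" for n
  proof (induction n)
    case 0
    show ?case by (rule fps_ext) simp
  next
    case (Suc n)
    have "?q (1 - fps_X) = 1 - fps_X" by (rule fps_ext) simp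
    with Suc show ?case by (simp add: q_mult del: fps_sub_nth)
  qed
  have unit: "fps_nth ((1 - fps_X :: rat fps) ^ ?l) 0 \<noteq> 0"
    by (simp add: fps_nth_power_0)
  have "?q (?H * (1 - fps_X) ^ ?l) = ?q ?H * (1 - fps_X) ^ ?l"
    by (simp only: q_mult q_pow)
  also have "?q ?H = fps_of_poly (map_poly rat_of_int Q) / (1 - fps_X) ^ ?l"
    by (simp add: fiber_hilbert_series_def assms[symmetric])
  also have "\<dots> * (1 - fps_X) ^ ?l = fps_of_poly (map_poly rat_of_int Q)"
    using unit by (simp add: fps_divide_unit mult.assoc inverse_mult_eq_1)
  finally have "fps_nth (?q (?H * (1 - fps_X) ^ ?l)) i =
      fps_nth (fps_of_poly (map_poly rat_of_int Q)) i"
    by simp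
  then show ?thesis
    by (simp add: h_vector_def coeff_map_poly)
qed

end

theory Submission
  imports Defs "HOL-Algebra.UnivPoly"
begin

text \<open>
  Write \<open>H\<^sub>k\<close> for the value at \<open>k\<close> of the Hilbert function of the fiber ring \<open>F(I)\<close> and \<open>l\<close> for the
  analytic spread. As \<open>(1 - t)\<^sup>l = 1 - l t + (l choose 2) t\<^sup>2 - \<dots>\<close>, the coefficient of \<open>t\<^sup>2\<close> in
  \<open>(H\<^sub>0 + H\<^sub>1 t + H\<^sub>2 t\<^sup>2 + \<dots>) (1 - t)\<^sup>l\<close> is
  \<open>h\<^sub>2 = H\<^sub>2 - l H\<^sub>1 + (l choose 2) H\<^sub>0\<close> (lemma \<open>h_vector_2\<close>). The formula therefore amounts to
  \<open>H\<^sub>0 = 1\<close>, \<open>H\<^sub>1 = \<mu>(I)\<close> and \<open>H\<^sub>2 = \<mu>(I\<^sup>2)\<close>, and the work lies in showing that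
  \<open>dim I\<^sup>k/\<mm>I\<^sup>k\<close>, a dimension over \<open>R/\<mm>\<close>, is the minimal number of generators of \<open>L = I\<^sup>k\<close>.

  Generators of \<open>L\<close> span \<open>L/\<mm>L\<close>, so the dimension is at most \<open>\<mu>(L)\<close>. Conversely, a finite set \<open>S\<close> of
  generators contains a subset \<open>T\<close> whose classes form a basis of \<open>L/\<mm>L\<close>; then \<open>L = (T) + \<mm>L\<close>, and
  Nakayama's lemma yields \<open>L = (T)\<close>, so that \<open>\<mu>(L)\<close> is at most the dimension. This is
  \<open>fiber_hilbert_function_eq_min_num_gens\<close>. The dimension is taken inside \<open>F(I)\<close>, which has to be
  recognised as a ring first: it is the image of the Rees algebra, a subring of \<open>R[t]\<close>.

  Both forms of Nakayama's lemma come from one statement about an arbitrary commutative ring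
  (lemma \<open>nakayama\<close>): if \<open>L\<close> is finitely generated and contained in \<open>N + \<mm>L\<close>, some \<open>u\<close> in \<open>1 + \<mm>\<close>
  satisfies \<open>uL \<subseteq> N\<close>. In a local ring \<open>u\<close> is a unit. In a graded ring the component of \<open>u\<close> of
  degree 0 is \<open>1\<close>, so that a homogeneous \<open>s\<close> of degree \<open>d\<close> is the component of \<open>us\<close> of degree \<open>d\<close>,
  and it lies in \<open>N\<close> as soon as \<open>N\<close> has homogeneous generators.

  That \<open>L\<close> is finitely generated is part of the hypothesis in the local case. In the graded case it
  is Hilbert's basis theorem, applied to the finitely many elements of degree 1 that generate
  \<open>R\<close> over the field \<open>A\<^sub>0\<close>.
\<close>

section \<open>Generated ideals\<close>

lemma (in ring) finsum_in_additive_subgroup: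
  assumes H: "additive_subgroup H R" and "finite A" "\<And>i. i \<in> A \<Longrightarrow> f i \<in> H"
  shows "(\<Oplus>i\<in>A. f i) \<in> H"
  using assms(2,3)
proof (induction A rule: finite_induct)
  case empty
  then show ?case using additive_subgroup.zero_closed[OF H] by simp
next
  case (insert x A)
  then show ?case
    using additive_subgroup.a_closed[OF H] additive_subgroup.a_Hcarr[OF H]
    by (subst finsum_insert) auto
qed

lemma (in cring) genideal_insert:
  assumes "a \<in> carrier R" "T \<subseteq> carrier R"
  shows "Idl (insert a T) = {r \<otimes> a \<oplus> y | r y. r \<in> carrier R \<and> y \<in> Idl T}" (is "_ = ?J")
proof
  have J: "?J = PIdl a <+>\<^bsub>R\<^esub> Idl T" by (auto simp: set_add_def' cgenideal_def)
  have iT: "ideal (Idl T) R" by (rule genideal_ideal[OF assms(2)])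
  have "ideal ?J R" unfolding J by (rule add_ideals[OF cgenideal_ideal[OF assms(1)] iT])
  moreover have "a \<in> ?J"
  proof -
    have "a = \<one> \<otimes> a \<oplus> \<zero>" using assms by simp
    then show ?thesis using additive_subgroup.zero_closed[OF ideal.axioms(1)[OF iT]] by blast
  qed
  moreover have "T \<subseteq> ?J"
  proof
    fix t assume t: "t \<in> T"
    then have "t \<in> Idl T" using genideal_self[OF assms(2)] by blast
    moreover have "t = \<zero> \<otimes> a \<oplus> t" using t assms by auto
    ultimately show "t \<in> ?J" by blast
  qed
  ultimately show "Idl (insert a T) \<subseteq> ?J" by (intro genideal_minimal) auto
  have iaT: "ideal (Idl (insert a T)) R" using assms by (intro genideal_ideal) auto
  have a: "a \<in> Idl (insert a T)" using assms by (auto intro: genideal_self[THEN subsetD])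
  have T: "Idl T \<subseteq> Idl (insert a T)" using assms by (intro subset_Idl_subset) auto
  show "?J \<subseteq> Idl (insert a T)"
    using ideal.I_l_closed[OF iaT a] T additive_subgroup.a_closed[OF ideal.axioms(1)[OF iaT]]
    by blast
qed

lemma (in cring) colon_ideal:
  assumes J: "ideal J R" and Y: "Y \<subseteq> carrier R"
  shows "ideal {x \<in> carrier R. \<forall>y\<in>Y. x \<otimes> y \<in> J} R" (is "ideal ?C R")
proof -
  interpret J: ideal J R by (rule J)
  have "y \<in> Y \<Longrightarrow> y \<in> carrier R" for y using Y by blast
  note [simp] = this
  show ?thesis
  proof (rule idealI[OF ring_axioms])
    show "subgroup ?C (add_monoid R)"
      by (rule add.subgroupI) (auto simp: l_distr l_minus intro!: exI[of _ \<zero>])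
    fix a x assume a: "a \<in> ?C" and x: "x \<in> carrier R"
    then show "x \<otimes> a \<in> ?C" by (auto simp: m_assoc J.I_l_closed)
    then show "a \<otimes> x \<in> ?C" using a x by (simp add: m_comm)
  qed
qed

text \<open>
  Elements are moved from a generating set to the ideal that it generates because the multipliers
  of \<open>y\<close> into \<open>J\<close> form an ideal.
\<close>

lemma (in cring) genideal_mult_closed:
  assumes "ideal J R" "S \<subseteq> carrier R" "y \<in> carrier R" "\<And>s. s \<in> S \<Longrightarrow> s \<otimes> y \<in> J" "x \<in> Idl S"
  shows "x \<otimes> y \<in> J"
proof -
  have "S \<subseteq> {x \<in> carrier R. \<forall>y\<in>{y}. x \<otimes> y \<in> J}" using assms by auto
  then have "Idl S \<subseteq> {x \<in> carrier R. \<forall>y\<in>{y}. x \<otimes> y \<in> J}"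
    using colon_ideal[of J "{y}"] assms by (intro genideal_minimal) auto
  then show ?thesis using assms(5) by blast
qed

lemma (in cring) ideal_prod_genideal:
  assumes "S \<subseteq> carrier R" "T \<subseteq> carrier R"
  shows "(Idl S) \<cdot> (Idl T) = Idl (S <#> T)"
proof
  have ST: "S <#> T \<subseteq> carrier R" using assms by (auto simp: set_mult_def)
  note i = genideal_ideal[OF assms(1)] genideal_ideal[OF assms(2)] genideal_ideal[OF ST]
  have prods: "i \<otimes> j \<in> Idl (S <#> T)" if ij: "i \<in> Idl S" "j \<in> Idl T" for i j
  proof (rule genideal_mult_closed[OF i(3) assms(1) _ _ ij(1)])
    show j: "j \<in> carrier R" using ideal.Icarr[OF i(2) ij(2)] .
    fix s assume s: "s \<in> S"
    then have sR: "s \<in> carrier R" using assms by blast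
    have "j \<otimes> s \<in> Idl (S <#> T)"
    proof (rule genideal_mult_closed[OF i(3) assms(2) sR _ ij(2)])
      fix t assume t: "t \<in> T"
      then have "s \<otimes> t \<in> S <#> T" using s by (auto simp: set_mult_def)
      then show "t \<otimes> s \<in> Idl (S <#> T)"
        using genideal_self[OF ST] m_comm[of t s] sR subsetD[OF assms(2) t] by auto
    qed
    then show "s \<otimes> j \<in> Idl (S <#> T)" using m_comm[OF sR j] by simp
  qed
  show "(Idl S) \<cdot> (Idl T) \<subseteq> Idl (S <#> T)"
  proof
    fix x assume "x \<in> (Idl S) \<cdot> (Idl T)"
    then show "x \<in> Idl (S <#> T)"
    proof (induction rule: ideal_prod.induct)
      case (sum x y)
      then show ?case using additive_subgroup.a_closed[OF ideal.axioms(1)[OF i(3)]] by blast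
    qed (rule prods)
  qed
  show "Idl (S <#> T) \<subseteq> (Idl S) \<cdot> (Idl T)"
    using genideal_self[OF assms(1)] genideal_self[OF assms(2)]
    by (intro genideal_minimal[OF ideal_prod_is_ideal[OF i(1,2)]])
      (auto simp: set_mult_def intro: ideal_prod.prod)
qed

lemma (in cring) ideal_prod_insert:
  assumes M: "ideal M R" and s: "s \<in> carrier R" and S: "S \<subseteq> carrier R" and w: "w \<in> M \<cdot> (Idl (insert s S))"
  obtains a z where "a \<in> M" "z \<in> M \<cdot> (Idl S)" "w = a \<otimes> s \<oplus> z"
proof -
  interpret M: ideal M R by (rule M)
  have iS: "ideal (Idl S) R" by (rule genideal_ideal[OF S])
  interpret MS: ideal "M \<cdot> (Idl S)" R by (rule ideal_prod_is_ideal[OF M iS])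
  have "\<exists>a\<in>M. \<exists>z\<in>M \<cdot> (Idl S). w = a \<otimes> s \<oplus> z"
    using w
  proof (induction rule: ideal_prod.induct)
    case (prod i j)
    then obtain r y where ry: "r \<in> carrier R" "y \<in> Idl S" "j = r \<otimes> s \<oplus> y"
      using genideal_insert[OF s S] by blast
    have c: "i \<in> carrier R" "y \<in> carrier R" using M.Icarr[OF prod(1)] ideal.Icarr[OF iS ry(2)] .
    have "i \<otimes> j = (i \<otimes> r) \<otimes> s \<oplus> i \<otimes> y" unfolding ry(3) using c ry(1) s by algebra
    moreover have "i \<otimes> r \<in> M" "i \<otimes> y \<in> M \<cdot> (Idl S)"
      using M.I_r_closed[OF prod(1) ry(1)] ideal_prod.prod[OF prod(1) ry(2)] .
    ultimately show ?case by blast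
  next
    case (sum x y)
    then obtain a z b v where *: "a \<in> M" "z \<in> M \<cdot> (Idl S)" "x = a \<otimes> s \<oplus> z"
      "b \<in> M" "v \<in> M \<cdot> (Idl S)" "y = b \<otimes> s \<oplus> v" by blast
    have "x \<oplus> y = (a \<oplus> b) \<otimes> s \<oplus> (z \<oplus> v)"
      unfolding *(3,6) using M.Icarr[OF *(1)] M.Icarr[OF *(4)] MS.Icarr[OF *(2)] MS.Icarr[OF *(5)] s
      by algebra
    moreover have "a \<oplus> b \<in> M" "z \<oplus> v \<in> M \<cdot> (Idl S)" using * by simp_all
    ultimately show ?case by blast
  qed
  then show ?thesis using that by blast
qed

text \<open>
  An ideal that is finitely generated can be generated by finitely many elements of any given
  generating set: the ideals generated by the finite subsets form a directed family, whose union
  is an ideal.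
\<close>

lemma (in ring) finite_subset_genideal:
  assumes X: "X \<subseteq> carrier R" and F: "finite F" "F \<subseteq> Idl X"
  shows "\<exists>Y. finite Y \<and> Y \<subseteq> X \<and> F \<subseteq> Idl Y"
proof -
  let ?U = "\<Union>Y\<in>{Y. finite Y \<and> Y \<subseteq> X}. Idl Y"
  have i: "ideal (Idl Y) R" if "Y \<subseteq> X" for Y using that X by (intro genideal_ideal) auto
  have mono: "Idl Y \<subseteq> Idl (Y \<union> Z)" "Idl Z \<subseteq> Idl (Y \<union> Z)" if "Y \<subseteq> X" "Z \<subseteq> X" for Y Z
    by (rule subset_Idl_subset; use that X in blast)+
  have "ideal ?U R"
  proof (rule idealI[OF ring_axioms])
    show "subgroup ?U (add_monoid R)"
    proof (rule add.subgroupI)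
      show "?U \<subseteq> carrier R" using ideal.Icarr[OF i] by blast
      have "\<zero> \<in> Idl {}" using additive_subgroup.zero_closed[OF ideal.axioms(1)[OF i]] by blast
      then show "?U \<noteq> {}" by blast
      fix a assume "a \<in> ?U"
      then obtain Y where Y: "finite Y" "Y \<subseteq> X" "a \<in> Idl Y" by blast
      then have "\<ominus> a \<in> Idl Y" using additive_subgroup.a_inv_closed[OF ideal.axioms(1)[OF i]] by blast
      then show "\<ominus> a \<in> ?U" using Y by blast
      fix b assume "b \<in> ?U"
      then obtain Z where Z: "finite Z" "Z \<subseteq> X" "b \<in> Idl Z" by blast
      have "a \<oplus> b \<in> Idl (Y \<union> Z)"
        using additive_subgroup.a_closed[OF ideal.axioms(1)[OF i[of "Y \<union> Z"]]] mono[OF Y(2) Z(2)] Y Z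
        by blast
      moreover have "finite (Y \<union> Z)" "Y \<union> Z \<subseteq> X" using Y Z by auto
      ultimately show "a \<oplus> b \<in> ?U" by blast
    qed
    fix a x assume a: "a \<in> ?U" and x: "x \<in> carrier R"
    then obtain Y where Y: "finite Y" "Y \<subseteq> X" "a \<in> Idl Y" by blast
    show "x \<otimes> a \<in> ?U" using ideal.I_l_closed[OF i[OF Y(2)] Y(3) x] Y by blast
    show "a \<otimes> x \<in> ?U" using ideal.I_r_closed[OF i[OF Y(2)] Y(3) x] Y by blast
  qed
  moreover have "X \<subseteq> ?U"
  proof
    fix x assume "x \<in> X"
    then have "finite {x}" "{x} \<subseteq> X" "x \<in> Idl {x}" using X genideal_self' by auto
    then show "x \<in> ?U" by blast
  qed
  ultimately have sub: "Idl X \<subseteq> ?U" by (rule genideal_minimal)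
  show ?thesis using F
  proof (induction F rule: finite_induct)
    case empty
    then show ?case by (intro exI[of _ "{}"]) simp
  next
    case (insert f F)
    then obtain Y where Y: "finite Y" "Y \<subseteq> X" "F \<subseteq> Idl Y" by auto
    have "f \<in> ?U" using insert.prems sub by blast
    then obtain Z where Z: "finite Z" "Z \<subseteq> X" "f \<in> Idl Z" by blast
    have "insert f F \<subseteq> Idl (Y \<union> Z)" using mono[OF Y(2) Z(2)] Y(3) Z(3) by auto
    moreover have "finite (Y \<union> Z)" "Y \<union> Z \<subseteq> X" using Y Z by auto
    ultimately show ?case by blast
  qed
qed

section \<open>Hilbert's basis theorem\<close>

text \<open>
  Polynomial expressions in \<open>x\<close> of degree less than \<open>n\<close>, as elements of \<open>R\<close>. The element \<open>x\<close> may be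
  algebraic over \<open>B\<close>, so that an element can have several such expressions; the proof of the
  basis theorem works with expressions and does not compare coefficients.
\<close>

primrec (in ring) polys_below :: "'a set \<Rightarrow> 'a \<Rightarrow> nat \<Rightarrow> 'a set" where
  "polys_below B x 0 = {\<zero>}"
| "polys_below B x (Suc n) = {b \<otimes> x [^] n \<oplus> p | b p. b \<in> B \<and> p \<in> polys_below B x n}"

text \<open>
  When \<open>x\<close> is transcendental over \<open>B\<close>, these are \<open>0\<close> and the leading coefficients of the polynomials
  of degree \<open>n\<close> in \<open>J\<close>.
\<close>

definition (in ring) leading_coeffs :: "'a set \<Rightarrow> 'a \<Rightarrow> 'a set \<Rightarrow> nat \<Rightarrow> 'a set" where
  "leading_coeffs B x J n = {b \<in> B. \<exists>p\<in>polys_below B x n. b \<otimes> x [^] n \<oplus> p \<in> J}"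

context cring
begin

context
  fixes B :: "'a set" and x :: 'a
  assumes B: "subring B R" and x: "x \<in> carrier R"
begin

private lemma B_carrier [simp]: "b \<in> B \<Longrightarrow> b \<in> carrier R"
  using subringE(1)[OF B] by blast

private lemmas B_closed [simp] = subringE(2,3,5,6,7)[OF B]

declare x [simp]

lemma polys_below_carrier: "p \<in> polys_below B x n \<Longrightarrow> p \<in> carrier R"
  by (induction n arbitrary: p) auto

lemma polys_below_Suc_I:
  "b \<in> B \<Longrightarrow> p \<in> polys_below B x n \<Longrightarrow> b \<otimes> x [^] n \<oplus> p \<in> polys_below B x (Suc n)"
  by auto

lemma zero_polys_below: "\<zero> \<in> polys_below B x n"
proof (induction n)
  case (Suc n)
  then show ?case using polys_below_Suc_I[OF B_closed(1) Suc] by simp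
qed simp

lemma polys_below_Suc: "p \<in> polys_below B x n \<Longrightarrow> p \<in> polys_below B x (Suc n)"
  using polys_below_Suc_I[OF B_closed(1), of p n] polys_below_carrier[of p n] by simp

lemma polys_below_mono: "n \<le> m \<Longrightarrow> polys_below B x n \<subseteq> polys_below B x m"
  by (induction rule: dec_induct) (use polys_below_Suc in blast)+

lemma polys_below_add:
  "p \<in> polys_below B x n \<Longrightarrow> q \<in> polys_below B x n \<Longrightarrow> p \<oplus> q \<in> polys_below B x n"
proof (induction n arbitrary: p q)
  case (Suc n)
  then obtain b p' c q' where *: "b \<in> B" "p' \<in> polys_below B x n" "p = b \<otimes> x [^] n \<oplus> p'"
    "c \<in> B" "q' \<in> polys_below B x n" "q = c \<otimes> x [^] n \<oplus> q'" by auto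
  have "p \<oplus> q = (b \<oplus> c) \<otimes> x [^] n \<oplus> (p' \<oplus> q')"
    using * polys_below_carrier by (simp add: l_distr a_ac)
  then show ?case
    using polys_below_Suc_I[of "b \<oplus> c" "p' \<oplus> q'" n] Suc.IH * by simp
qed simp

lemma polys_below_smult:
  "b \<in> B \<Longrightarrow> p \<in> polys_below B x n \<Longrightarrow> b \<otimes> p \<in> polys_below B x n"
proof (induction n arbitrary: p)
  case (Suc n)
  then obtain c p' where *: "c \<in> B" "p' \<in> polys_below B x n" "p = c \<otimes> x [^] n \<oplus> p'" by auto
  have "b \<otimes> p = (b \<otimes> c) \<otimes> x [^] n \<oplus> b \<otimes> p'"
    using * Suc.prems polys_below_carrier by (simp add: r_distr m_assoc)
  then show ?case
    using polys_below_Suc_I[of "b \<otimes> c" "b \<otimes> p'" n] Suc.IH * Suc.prems by simp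
qed simp

lemma polys_below_uminus: "p \<in> polys_below B x n \<Longrightarrow> \<ominus> p \<in> polys_below B x n"
  using polys_below_smult[of "\<ominus> \<one>" p n] polys_below_carrier[of p n] by (simp add: l_minus)

lemma polys_below_shift: "p \<in> polys_below B x n \<Longrightarrow> x \<otimes> p \<in> polys_below B x (Suc n)"
proof (induction n arbitrary: p)
  case 0
  then show ?case using zero_polys_below[of 1] by simp
next
  case (Suc n)
  then obtain c p' where *: "c \<in> B" "p' \<in> polys_below B x n" "p = c \<otimes> x [^] n \<oplus> p'" by auto
  have "x \<otimes> p = c \<otimes> x [^] Suc n \<oplus> x \<otimes> p'"
    using * polys_below_carrier[of p' n] by (simp add: r_distr m_ac)
  then show ?case
    using polys_below_Suc_I[of c "x \<otimes> p'" "Suc n"] Suc.IH * by simp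
qed

lemma polys_below_power_shift:
  "p \<in> polys_below B x n \<Longrightarrow> x [^] m \<otimes> p \<in> polys_below B x (n + m)"
proof (induction m)
  case 0
  then show ?case using polys_below_carrier by simp
next
  case (Suc m)
  then show ?case
    using polys_below_shift[of "x [^] m \<otimes> p" "n + m"] polys_below_carrier[of p n]
    by (simp add: m_ac)
qed

lemma polys_below_mult:
  "p \<in> polys_below B x n \<Longrightarrow> q \<in> polys_below B x m \<Longrightarrow> p \<otimes> q \<in> polys_below B x (m + n)"
proof (induction n arbitrary: p)
  case 0
  then show ?case using zero_polys_below polys_below_carrier by simp
next
  case (Suc n)
  then obtain c p' where *: "c \<in> B" "p' \<in> polys_below B x n" "p = c \<otimes> x [^] n \<oplus> p'" by auto
  have "p \<otimes> q = c \<otimes> (x [^] n \<otimes> q) \<oplus> p' \<otimes> q"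
    using * Suc.prems polys_below_carrier by (simp add: l_distr m_assoc)
  moreover have "c \<otimes> (x [^] n \<otimes> q) \<oplus> p' \<otimes> q \<in> polys_below B x (m + n)"
    using polys_below_add[OF polys_below_smult[OF *(1) polys_below_power_shift[OF Suc.prems(2)]]
        Suc.IH[OF *(2) Suc.prems(2)]] .
  ultimately show ?case using polys_below_Suc by simp
qed

lemma Union_polys_below:
  assumes "generate_ring R (insert x B) = carrier R"
  shows "(\<Union>n. polys_below B x n) = carrier R"
proof
  let ?U = "\<Union>n. polys_below B x n"
  show "?U \<subseteq> carrier R" using polys_below_carrier by blast
  have "subring ?U R"
  proof (rule subringI)
    show "?U \<subseteq> carrier R" using polys_below_carrier by blast
    have "\<one> \<otimes> x [^] (0::nat) \<oplus> \<zero> \<in> polys_below B x (Suc 0)"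
      by (rule polys_below_Suc_I) simp_all
    then show "\<one> \<in> ?U" by (auto simp del: polys_below.simps)
    show "\<ominus> h \<in> ?U" if "h \<in> ?U" for h using that polys_below_uminus by blast
    fix h1 h2 assume "h1 \<in> ?U" "h2 \<in> ?U"
    then obtain n m where nm: "h1 \<in> polys_below B x n" "h2 \<in> polys_below B x m" by blast
    then show "h1 \<otimes> h2 \<in> ?U" using polys_below_mult by blast
    have "h1 \<in> polys_below B x (max n m)" "h2 \<in> polys_below B x (max n m)"
      using nm polys_below_mono[of n "max n m"] polys_below_mono[of m "max n m"] by auto
    then show "h1 \<oplus> h2 \<in> ?U" using polys_below_add by blast
  qed
  moreover have "insert x B \<subseteq> ?U"
  proof -
    have B1: "b \<in> polys_below B x (Suc 0)" if "b \<in> B" for b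
      using polys_below_Suc_I[OF that zero_polys_below[of 0]] that by simp
    moreover have "x \<in> polys_below B x (Suc (Suc 0))"
      using polys_below_shift[OF B1[OF B_closed(2)]] by simp
    ultimately show ?thesis by blast
  qed
  moreover have "insert x B \<subseteq> carrier R" by auto
  ultimately show "carrier R \<subseteq> ?U" using generate_ring_min_subring1[of "insert x B" ?U] assms by simp
qed

lemma ideal_leading_coeffs:
  assumes J: "ideal J R"
  shows "ideal (leading_coeffs B x J n) (R\<lparr>carrier := B\<rparr>)" (is "ideal ?L ?B")
proof -
  interpret J: ideal J R by (rule J)
  interpret B: ring ?B by (rule subring_is_ring[OF B])
  have smult: "c \<otimes> a \<in> ?L" if c: "c \<in> B" and a: "a \<in> ?L" for a c
  proof -
    obtain p where p: "a \<in> B" "p \<in> polys_below B x n" "a \<otimes> x [^] n \<oplus> p \<in> J"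
      using a unfolding leading_coeffs_def by blast
    have "(c \<otimes> a) \<otimes> x [^] n \<oplus> c \<otimes> p = c \<otimes> (a \<otimes> x [^] n \<oplus> p)"
      using p c polys_below_carrier[of p n] by (simp add: r_distr m_assoc)
    then have "(c \<otimes> a) \<otimes> x [^] n \<oplus> c \<otimes> p \<in> J" using J.I_l_closed[OF p(3)] c by simp
    then show ?thesis
      using p c polys_below_smult[of c p n] unfolding leading_coeffs_def by auto
  qed
  have sub: "?L \<subseteq> B" by (auto simp: leading_coeffs_def)
  show ?thesis
  proof (rule idealI[OF B.ring_axioms])
    show "subgroup ?L (add_monoid ?B)"
    proof (rule B.add.subgroupI)
      show "?L \<subseteq> carrier ?B" using sub by simp
      have "\<zero> \<otimes> x [^] n \<oplus> \<zero> \<in> J" by simp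
      then have "\<zero> \<in> ?L" using zero_polys_below[of n] B_closed(1) unfolding leading_coeffs_def by blast
      then show "?L \<noteq> {}" by blast
      fix a assume a: "a \<in> ?L"
      then have aB: "a \<in> B" using sub by blast
      have "\<ominus>\<^bsub>?B\<^esub> a = \<ominus> a"
        by (rule B.minus_equality) (use aB in \<open>simp_all add: l_neg\<close>)
      moreover have "\<ominus> a \<in> ?L" using smult[of "\<ominus> \<one>" a] a aB by (simp add: l_minus)
      ultimately show "\<ominus>\<^bsub>?B\<^esub> a \<in> ?L" by simp
      fix b assume b: "b \<in> ?L"
      obtain p q where *: "a \<in> B" "p \<in> polys_below B x n" "a \<otimes> x [^] n \<oplus> p \<in> J"
        "b \<in> B" "q \<in> polys_below B x n" "b \<otimes> x [^] n \<oplus> q \<in> J"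
        using a b unfolding leading_coeffs_def by blast
      have "(a \<oplus> b) \<otimes> x [^] n \<oplus> (p \<oplus> q) = (a \<otimes> x [^] n \<oplus> p) \<oplus> (b \<otimes> x [^] n \<oplus> q)"
        using * polys_below_carrier by (simp add: l_distr a_ac)
      then have "(a \<oplus> b) \<otimes> x [^] n \<oplus> (p \<oplus> q) \<in> J" using * by simp
      then have "a \<oplus> b \<in> ?L" using * polys_below_add unfolding leading_coeffs_def by auto
      then show "a \<oplus>\<^bsub>?B\<^esub> b \<in> ?L" by simp
    qed
    fix a c assume ac: "a \<in> ?L" "c \<in> carrier ?B"
    then show "c \<otimes>\<^bsub>?B\<^esub> a \<in> ?L" using smult by simp
    then show "a \<otimes>\<^bsub>?B\<^esub> c \<in> ?L" using ac sub m_comm[of a c] by auto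
  qed
qed

text \<open>
  Multiplication by \<open>x\<close> raises the degree and keeps the leading coefficient.
\<close>

lemma leading_coeffs_Suc:
  assumes "ideal J R"
  shows "leading_coeffs B x J n \<subseteq> leading_coeffs B x J (Suc n)"
proof
  fix b assume "b \<in> leading_coeffs B x J n"
  then obtain p where p: "b \<in> B" "p \<in> polys_below B x n" "b \<otimes> x [^] n \<oplus> p \<in> J"
    unfolding leading_coeffs_def by blast
  have "b \<otimes> x [^] Suc n \<oplus> x \<otimes> p = x \<otimes> (b \<otimes> x [^] n \<oplus> p)"
    using p polys_below_carrier[of p n] by (simp add: r_distr m_ac)
  then have "b \<otimes> x [^] Suc n \<oplus> x \<otimes> p \<in> J" using ideal.I_l_closed[OF assms p(3)] by simp
  then show "b \<in> leading_coeffs B x J (Suc n)"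
    using p(1) polys_below_shift[OF p(2)] unfolding leading_coeffs_def by blast
qed

lemma leading_coeffs_mono:
  assumes "ideal J R" "n \<le> m"
  shows "leading_coeffs B x J n \<subseteq> leading_coeffs B x J m"
  using assms(2) by (induction rule: dec_induct) (use leading_coeffs_Suc[OF assms(1)] in blast)+

text \<open>
  The division step: an element of \<open>J\<close> agrees in its leading term with an element of \<open>J0\<close>, and their
  difference lies in \<open>J\<close> and has smaller degree.
\<close>

lemma subset_of_leading_coeffs_subset:
  assumes gen: "generate_ring R (insert x B) = carrier R"
    and J: "ideal J R" and J0: "ideal J0 R" "J0 \<subseteq> J"
    and lead: "\<And>n. leading_coeffs B x J n \<subseteq> leading_coeffs B x J0 n"
  shows "J \<subseteq> J0"
proof -
  interpret J: ideal J R by (rule J)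
  interpret J0: ideal J0 R by (rule J0)
  have "p \<in> J0" if "p \<in> polys_below B x n" "p \<in> J" for n p
    using that
  proof (induction n arbitrary: p)
    case (Suc n)
    then obtain b q where bq: "b \<in> B" "q \<in> polys_below B x n" "p = b \<otimes> x [^] n \<oplus> q" by auto
    then have "b \<in> leading_coeffs B x J0 n"
      using lead[of n] Suc.prems(2) unfolding leading_coeffs_def by blast
    then obtain r where r: "r \<in> polys_below B x n" "b \<otimes> x [^] n \<oplus> r \<in> J0"
      unfolding leading_coeffs_def by blast
    have c: "b \<otimes> x [^] n \<in> carrier R" "q \<in> carrier R" "r \<in> carrier R"
      using bq r polys_below_carrier by auto
    have eq: "p = (b \<otimes> x [^] n \<oplus> r) \<oplus> (q \<oplus> \<ominus> r)"
      and eq': "q \<oplus> \<ominus> r = p \<oplus> \<ominus> (b \<otimes> x [^] n \<oplus> r)"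
      unfolding bq(3) using c by algebra+
    have "q \<oplus> \<ominus> r \<in> J" unfolding eq' using Suc.prems(2) r(2) J0(2) by auto
    then have "q \<oplus> \<ominus> r \<in> J0"
      using bq(2) r(1) by (intro Suc.IH polys_below_add polys_below_uminus)
    then show ?case unfolding eq using r(2) by simp
  qed simp
  then show ?thesis using Union_polys_below[OF gen] J.Icarr by blast
qed

text \<open>
  The ideals of leading coefficients of \<open>J\<close> in degrees \<open>0, 1, 2, \<dots>\<close> form a chain in \<open>B\<close>, which
  becomes stationary at some \<open>N\<close>. Elements of \<open>J\<close> whose leading coefficients generate the first
  \<open>N + 1\<close> of these ideals generate \<open>J\<close>, since they account for the leading coefficients in all
  degrees.
\<close>

theorem hilbert_basis:
  assumes noeth: "noetherian_ring (R\<lparr>carrier := B\<rparr>)"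
    and gen: "generate_ring R (insert x B) = carrier R"
  shows "noetherian_ring R"
proof (rule noetherian_ringI)
  interpret NB: noetherian_ring "R\<lparr>carrier := B\<rparr>" by (rule noeth)
  fix J assume J: "ideal J R"
  let ?L = "leading_coeffs B x J"
  have "subset.chain {I. ideal I (R\<lparr>carrier := B\<rparr>)} (range ?L)"
  proof -
    have "?L n \<subseteq> ?L m \<or> ?L m \<subseteq> ?L n" for n m
      using leading_coeffs_mono[OF J, of n m] leading_coeffs_mono[OF J, of m n] nat_le_linear by blast
    then show ?thesis
      using ideal_leading_coeffs[OF J] unfolding subset_chain_def by blast
  qed
  then have "\<Union>(range ?L) \<in> range ?L" by (intro NB.ideal_chain_is_trivial) auto
  then obtain N where N: "\<And>n. ?L n \<subseteq> ?L N" by blast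
  have "\<exists>G. finite G \<and> G \<subseteq> J \<and> (\<forall>J0. ideal J0 R \<and> G \<subseteq> J0 \<longrightarrow> ?L n \<subseteq> leading_coeffs B x J0 n)" for n
  proof -
    obtain C where C: "C \<subseteq> B" "finite C" "?L n = Idl\<^bsub>R\<lparr>carrier := B\<rparr>\<^esub> C"
      using NB.finetely_gen[OF ideal_leading_coeffs[OF J, of n]] by auto
    have "C \<subseteq> ?L n" using NB.genideal_self[of C] C by simp
    then have "\<forall>c\<in>C. \<exists>p. p \<in> polys_below B x n \<and> c \<otimes> x [^] n \<oplus> p \<in> J"
      unfolding leading_coeffs_def by blast
    then obtain p where p: "\<And>c. c \<in> C \<Longrightarrow> p c \<in> polys_below B x n"
      "\<And>c. c \<in> C \<Longrightarrow> c \<otimes> x [^] n \<oplus> p c \<in> J" by metis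
    have "?L n \<subseteq> leading_coeffs B x J0 n"
      if J0: "ideal J0 R" "(\<lambda>c. c \<otimes> x [^] n \<oplus> p c) ` C \<subseteq> J0" for J0
      unfolding C(3)
    proof (rule NB.genideal_minimal[OF ideal_leading_coeffs[OF J0(1)]])
      show "C \<subseteq> leading_coeffs B x J0 n"
        using C(1) p(1) J0(2) unfolding leading_coeffs_def by blast
    qed
    then show ?thesis
      using C(2) p(2) by (intro exI[of _ "(\<lambda>c. c \<otimes> x [^] n \<oplus> p c) ` C"]) auto
  qed
  then obtain G where G: "\<And>n. finite (G n)" "\<And>n. G n \<subseteq> J"
    "\<And>n J0. ideal J0 R \<Longrightarrow> G n \<subseteq> J0 \<Longrightarrow> ?L n \<subseteq> leading_coeffs B x J0 n" by metis
  define S where "S = (\<Union>n\<in>{..N}. G n)"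
  have S: "finite S" "S \<subseteq> J" using G by (auto simp: S_def)
  have Sc: "S \<subseteq> carrier R" using S(2) ideal.Icarr[OF J] by blast
  have iS: "ideal (Idl S) R" by (rule genideal_ideal[OF Sc])
  have SJ: "Idl S \<subseteq> J" by (rule genideal_minimal[OF J S(2)])
  have low: "?L n \<subseteq> leading_coeffs B x (Idl S) n" if "n \<le> N" for n
    using that genideal_self[OF Sc] by (intro G(3)[OF iS]) (auto simp: S_def)
  have "?L n \<subseteq> leading_coeffs B x (Idl S) n" for n
  proof (cases "n \<le> N")
    case False
    then have "leading_coeffs B x (Idl S) N \<subseteq> leading_coeffs B x (Idl S) n"
      by (intro leading_coeffs_mono[OF iS]) simp
    then show ?thesis using N[of n] low[of N] by auto
  qed (rule low)
  then have "J \<subseteq> Idl S" by (rule subset_of_leading_coeffs_subset[OF gen J iS SJ])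
  then show "\<exists>A\<subseteq>carrier R. finite A \<and> J = Idl A"
    using S(1) Sc SJ by blast
qed

end

lemma noetherian_finitely_generated_extension:
  assumes B: "subring B R" "noetherian_ring (R\<lparr>carrier := B\<rparr>)"
    and S: "finite S" "S \<subseteq> carrier R"
  shows "noetherian_ring (R\<lparr>carrier := generate_ring R (B \<union> S)\<rparr>)"
  using S
proof (induction S rule: finite_induct)
  case empty
  have Bc: "B \<subseteq> carrier R" by (rule subringE(1)[OF B(1)])
  have "generate_ring R B = B"
    using generate_ring_min_subring1[OF Bc B(1)] generate_ringE(2)[OF Bc refl] by blast
  then show ?case using B(2) by simp
next
  case (insert s S)
  have Bc: "B \<subseteq> carrier R" by (rule subringE(1)[OF B(1)])
  let ?C = "generate_ring R (B \<union> S)" and ?D = "generate_ring R (B \<union> insert s S)"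
  have c: "B \<union> S \<subseteq> carrier R" "B \<union> insert s S \<subseteq> carrier R" using Bc insert.prems by auto
  have CD: "?C \<subseteq> ?D" by (rule mono_generate_ring[OF _ c(2)]) auto
  have s: "s \<in> ?D" and BS: "B \<union> S \<subseteq> ?C"
    using generate_ringE(2)[OF c(2) refl] generate_ringE(2)[OF c(1) refl] by auto
  have sub: "subring ?C R" "subring ?D R" using generate_ring_is_subring c by auto
  interpret D: cring "R\<lparr>carrier := ?D\<rparr>"
    using subcring_iff[OF subringE(1)[OF sub(2)]] subcringI'[OF sub(2)] by blast
  have subD: "subring ?C (R\<lparr>carrier := ?D\<rparr>)"
    using subring_is_ring[OF sub(1)] CD by (subst D.subring_iff) auto
  have sC: "insert s ?C \<subseteq> ?D" using s CD by blast
  have "generate_ring (R\<lparr>carrier := ?D\<rparr>) (insert s ?C) = generate_ring R (insert s ?C)"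
    by (rule subring_gen_equality[OF sub(2) sC, symmetric])
  also have "\<dots> = ?D"
  proof
    have cc: "insert s ?C \<subseteq> carrier R" using sC subringE(1)[OF sub(2)] by blast
    show "generate_ring R (insert s ?C) \<subseteq> ?D" by (rule generate_ring_min_subring1[OF cc sub(2) sC])
    have "B \<union> insert s S \<subseteq> generate_ring R (insert s ?C)"
      using BS generate_ringE(2)[OF cc refl] by blast
    then show "?D \<subseteq> generate_ring R (insert s ?C)"
      by (rule generate_ring_min_subring1[OF c(2) generate_ring_is_subring[OF cc]])
  qed
  finally have gen: "generate_ring (R\<lparr>carrier := ?D\<rparr>) (insert s ?C) = carrier (R\<lparr>carrier := ?D\<rparr>)"
    by simp
  show ?case
    using D.hilbert_basis[OF subD _ _ gen] s insert.IH insert.prems by simp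
qed

end

lemma (in field) field_is_noetherian: "noetherian_ring R"
proof (rule noetherian_ringI)
  fix I assume "ideal I R"
  then have "I = {\<zero>} \<or> I = carrier R" using all_ideals by blast
  then show "\<exists>A\<subseteq>carrier R. finite A \<and> I = Idl A"
  proof
    assume "I = {\<zero>}"
    then show ?thesis using genideal_zero by (intro exI[of _ "{\<zero>}"]) simp
  next
    assume "I = carrier R"
    then show ?thesis using genideal_one by (intro exI[of _ "{\<one>}"]) simp
  qed
qed

lemma (in standard_graded_algebra) standard_graded_algebra_is_noetherian: "noetherian_ring R"
proof -
  obtain S where S: "finite S" "S \<subseteq> A 1" "generate_ring R (A 0 \<union> S) = carrier R"
    using standard by blast
  have "S \<subseteq> carrier R" using S(2) additive_subgroup.a_subset[OF component_subgroup] by blast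
  moreover have "noetherian_ring (R\<lparr>carrier := A 0\<rparr>)"
    using field.field_is_noetherian[OF subfield_iff(2)[OF base_field]] .
  ultimately have "noetherian_ring (R\<lparr>carrier := generate_ring R (A 0 \<union> S)\<rparr>)"
    using noetherian_finitely_generated_extension[OF subfieldE(1)[OF base_field]] S(1) by blast
  then show ?thesis by (simp add: S(3))
qed

section \<open>Nakayama's lemma\<close>

text \<open>
  The multiplier \<open>u\<close> replaces the determinant of the usual proof and is built by induction on the
  number of generators. Let \<open>L\<close> be the ideal generated by \<open>S\<close>. To remove a generator
  \<open>s\<close>, it is first added to \<open>N\<close>; the induction hypothesis gives \<open>u\<close> with \<open>uL \<subseteq> N + Rs\<close>. Then
  \<open>u (ML) \<subseteq> N + Ms\<close>, and \<open>s \<in> N + ML\<close> gives \<open>us \<in> N + bs\<close> for some \<open>b \<in> M\<close>. Hence \<open>v = u - b\<close>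
  moves \<open>s\<close> into \<open>N\<close>, and \<open>vu\<close> moves all of \<open>L\<close> into \<open>N\<close>.
\<close>

lemma (in cring) nakayama:
  assumes M: "ideal M R" and N: "ideal N R" and S: "finite S" "S \<subseteq> carrier R"
    and cover: "S \<subseteq> N <+>\<^bsub>R\<^esub> M \<cdot> (Idl S)"
  shows "\<exists>u\<in>carrier R. u \<ominus> \<one> \<in> M \<and> (\<forall>s\<in>S. u \<otimes> s \<in> N)"
  using S N cover
proof (induction S arbitrary: N rule: finite_induct)
  case empty
  then show ?case
    using additive_subgroup.zero_closed[OF ideal.axioms(1)[OF M]]
    by (intro bexI[of _ \<one>]) (auto simp: minus_eq r_neg)
next
  case (insert s S)
  interpret M: ideal M R by (rule M)
  interpret N: ideal N R by (rule insert.prems(2))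
  have s: "s \<in> carrier R" and S: "S \<subseteq> carrier R" using insert.prems by auto
  have sS: "insert s S \<subseteq> carrier R" using s S by blast
  let ?L = "Idl (insert s S)"
  have iL: "ideal ?L R" by (rule genideal_ideal[OF sS])
  define N' where "N' = {n \<oplus> r \<otimes> s | n r. n \<in> N \<and> r \<in> carrier R}"
  have N'_eq: "N' = N <+>\<^bsub>R\<^esub> PIdl s" by (auto simp: N'_def set_add_def' cgenideal_def)
  have iN': "ideal N' R"
    unfolding N'_eq by (rule add_ideals[OF N.ideal_axioms cgenideal_ideal[OF s]])
  have "S \<subseteq> N' <+>\<^bsub>R\<^esub> M \<cdot> (Idl S)"
  proof
    fix t assume "t \<in> S"
    then have "t \<in> N <+>\<^bsub>R\<^esub> M \<cdot> ?L" using insert.prems(3) by blast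
    then obtain n w where nw: "n \<in> N" "w \<in> M \<cdot> ?L" "t = n \<oplus> w" unfolding set_add_def' by blast
    obtain a z where az: "a \<in> M" "z \<in> M \<cdot> (Idl S)" "w = a \<otimes> s \<oplus> z"
      using ideal_prod_insert[OF M s S nw(2)] .
    have "z \<in> carrier R"
      using ideal.Icarr[OF ideal_prod_is_ideal[OF M genideal_ideal[OF S]] az(2)] .
    then have "t = (n \<oplus> a \<otimes> s) \<oplus> z"
      using nw az s M.Icarr[OF az(1)] N.Icarr[OF nw(1)] by (simp add: a_assoc)
    moreover have "n \<oplus> a \<otimes> s \<in> N'" unfolding N'_def using nw(1) M.Icarr[OF az(1)] by blast
    ultimately show "t \<in> N' <+>\<^bsub>R\<^esub> M \<cdot> (Idl S)" using az(2) unfolding set_add_def' by blast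
  qed
  then obtain u where u: "u \<in> carrier R" "u \<ominus> \<one> \<in> M" "\<And>t. t \<in> S \<Longrightarrow> u \<otimes> t \<in> N'"
    using insert.IH[OF S iN'] by blast
  have "s \<in> N'"
  proof -
    have "s = \<zero> \<oplus> \<one> \<otimes> s" using s by simp
    then show ?thesis unfolding N'_def using N.zero_closed by blast
  qed
  then have "u \<otimes> s \<in> N'" using ideal.I_l_closed[OF iN'] u(1) by blast
  then have gens: "t \<otimes> u \<in> N'" if t: "t \<in> insert s S" for t
    unfolding m_comm[OF subsetD[OF sS t] u(1)] using t \<open>u \<otimes> s \<in> N'\<close> u(3) by blast
  have uL: "u \<otimes> x \<in> N'" if x: "x \<in> ?L" for x
    using genideal_mult_closed[OF iN' sS u(1) gens x] m_comm[OF u(1) ideal.Icarr[OF iL x]] by simp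
  have uML: "\<exists>n\<in>N. \<exists>b\<in>M. u \<otimes> w = n \<oplus> b \<otimes> s" if "w \<in> M \<cdot> ?L" for w
    using that
  proof (induction rule: ideal_prod.induct)
    case (prod i j)
    obtain n r where nr: "n \<in> N" "r \<in> carrier R" "u \<otimes> j = n \<oplus> r \<otimes> s"
      using uL[OF prod(2)] unfolding N'_def by blast
    have c: "i \<in> carrier R" "j \<in> carrier R" "n \<in> carrier R"
      using M.Icarr[OF prod(1)] ideal.Icarr[OF iL prod(2)] N.Icarr[OF nr(1)] .
    have "u \<otimes> (i \<otimes> j) = i \<otimes> (u \<otimes> j)" using c u(1) by algebra
    also have "\<dots> = i \<otimes> n \<oplus> (i \<otimes> r) \<otimes> s" unfolding nr(3) using c nr(2) s by algebra
    finally show ?case using N.I_l_closed[OF nr(1) c(1)] M.I_r_closed[OF prod(1) nr(2)] by blast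
  next
    case (sum x y)
    then obtain n b n' b' where *: "n \<in> N" "b \<in> M" "u \<otimes> x = n \<oplus> b \<otimes> s"
      "n' \<in> N" "b' \<in> M" "u \<otimes> y = n' \<oplus> b' \<otimes> s" by blast
    have c: "x \<in> carrier R" "y \<in> carrier R"
      using ideal.Icarr[OF ideal_prod_is_ideal[OF M iL]] sum.hyps by blast+
    have "u \<otimes> (x \<oplus> y) = u \<otimes> x \<oplus> u \<otimes> y" using c u(1) by algebra
    also have "\<dots> = (n \<oplus> n') \<oplus> (b \<oplus> b') \<otimes> s"
      unfolding *(3,6) using * N.Icarr M.Icarr s by (simp add: l_distr a_ac)
    finally show ?case using * by (meson N.a_closed M.a_closed)
  qed
  obtain n w where nw: "n \<in> N" "w \<in> M \<cdot> ?L" "s = n \<oplus> w"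
    using insert.prems(3) unfolding set_add_def' by blast
  obtain n' b where nb: "n' \<in> N" "b \<in> M" "u \<otimes> w = n' \<oplus> b \<otimes> s" using uML[OF nw(2)] by blast
  have c: "n \<in> carrier R" "n' \<in> carrier R" "b \<in> carrier R" "w \<in> carrier R"
    using nw nb N.Icarr M.Icarr ideal.Icarr[OF ideal_prod_is_ideal[OF M iL]] by auto
  define v where "v = u \<ominus> b"
  have v: "v \<in> carrier R" using u c by (simp add: v_def)
  have "v \<otimes> s = u \<otimes> s \<ominus> b \<otimes> s" unfolding v_def using u c s by algebra
  also have "u \<otimes> s = u \<otimes> n \<oplus> u \<otimes> w" using nw(3) r_distr[OF c(1,4) u(1)] by simp
  also have "u \<otimes> n \<oplus> u \<otimes> w \<ominus> b \<otimes> s = u \<otimes> n \<oplus> n'" unfolding nb(3) using u c s by algebra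
  finally have vs: "v \<otimes> s \<in> N" using N.I_l_closed[OF nw(1) u(1)] nb(1) by simp
  have vM: "v \<ominus> \<one> \<in> M"
  proof -
    have "v \<ominus> \<one> = (u \<ominus> \<one>) \<oplus> \<ominus> b" unfolding v_def using u c by algebra
    then show ?thesis using u(2) nb(2) by simp
  qed
  show ?case
  proof (intro bexI[of _ "v \<otimes> u"] conjI ballI)
    show "v \<otimes> u \<in> carrier R" using u v by simp
    have "v \<otimes> u \<ominus> \<one> = v \<otimes> (u \<ominus> \<one>) \<oplus> (v \<ominus> \<one>)" using u v by algebra
    then show "v \<otimes> u \<ominus> \<one> \<in> M" using M.I_l_closed[OF u(2) v] vM by simp
    fix t assume t: "t \<in> insert s S"
    then have tR: "t \<in> carrier R" using sS by blast
    have "u \<otimes> t \<in> N'" using gens[OF t] m_comm[OF u(1) tR] by simp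
    then obtain p r where pr: "p \<in> N" "r \<in> carrier R" "u \<otimes> t = p \<oplus> r \<otimes> s" unfolding N'_def by blast
    have "(v \<otimes> u) \<otimes> t = v \<otimes> p \<oplus> r \<otimes> (v \<otimes> s)"
      unfolding m_assoc[OF v u(1) tR] pr(3) using N.Icarr[OF pr(1)] pr(2) v s by algebra
    then show "(v \<otimes> u) \<otimes> t \<in> N" using N.I_l_closed[OF pr(1) v] N.I_l_closed[OF vs pr(2)] by simp
  qed
qed

text \<open>
  Zorn's lemma applies at once, since the union of a chain of ideals in a Noetherian ring is a
  member of the chain.
\<close>

lemma (in noetherian_ring) ideal_subset_maximalideal:
  assumes "ideal J R" "J \<noteq> carrier R"
  shows "\<exists>M. maximalideal M R \<and> J \<subseteq> M"
proof -
  let ?A = "{M. ideal M R \<and> J \<subseteq> M \<and> M \<noteq> carrier R}"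
  have "\<exists>M\<in>?A. \<forall>X\<in>?A. M \<subseteq> X \<longrightarrow> X = M"
  proof (rule subset_Zorn_nonempty)
    show "?A \<noteq> {}" using assms by blast
    fix C assume C: "C \<noteq> {}" "subset.chain ?A C"
    then have "subset.chain {I. ideal I R} C" by (auto simp: subset.chain_def)
    then have "\<Union>C \<in> C" by (rule ideal_chain_is_trivial[OF C(1)])
    then show "\<Union>C \<in> ?A" using C(2) by (auto simp: subset.chain_def)
  qed
  then obtain M where M: "M \<in> ?A" and max: "\<forall>X\<in>?A. M \<subseteq> X \<longrightarrow> X = M" by (rule bexE)
  have "maximalideal M R"
  proof (rule maximalidealI)
    show "ideal M R" "carrier R \<noteq> M" using M by auto
    fix X assume X: "ideal X R" "M \<subseteq> X"
    show "X = M \<or> X = carrier R"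
    proof (cases "X = carrier R")
      case False
      then have "X \<in> ?A" using X M by auto
      then show ?thesis using max X(2) by simp
    qed simp
  qed
  then show ?thesis using M by blast
qed

lemma (in noetherian_local_ring) unit_of_not_mem:
  assumes "u \<in> carrier R" "u \<notin> \<mm>"
  shows "u \<in> Units R"
proof (rule ccontr)
  assume "u \<notin> Units R"
  then have "PIdl u \<noteq> carrier R" using ideal_eq_carrier_iff[OF assms(1)] by simp
  then obtain M where "maximalideal M R" "PIdl u \<subseteq> M"
    using ideal_subset_maximalideal[OF cgenideal_ideal[OF assms(1)]] by blast
  then show False using maximal_unique assms cgenideal_self[OF assms(1)] by blast
qed

lemma (in noetherian_local_ring) nakayama_local:
  assumes S: "finite S" "S \<subseteq> carrier R" and N: "ideal N R"
    and cover: "Idl S \<subseteq> N <+>\<^bsub>R\<^esub> \<mm> \<cdot> (Idl S)"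
  shows "Idl S \<subseteq> N"
proof -
  interpret M: maximalideal \<mm> R by (rule maximal)
  obtain u where u: "u \<in> carrier R" "u \<ominus> \<one> \<in> \<mm>" "\<And>s. s \<in> S \<Longrightarrow> u \<otimes> s \<in> N"
    using nakayama[OF M.ideal_axioms N S] cover genideal_self[OF S(2)] by blast
  have "u \<notin> \<mm>"
  proof
    assume "u \<in> \<mm>"
    then have "u \<oplus> \<ominus> (u \<ominus> \<one>) \<in> \<mm>" using u(2) by simp
    moreover have "u \<oplus> \<ominus> (u \<ominus> \<one>) = \<one>" using u(1) by algebra
    ultimately show False using M.one_imp_carrier M.I_notcarr by simp
  qed
  then have un: "u \<in> Units R" using unit_of_not_mem u(1) by blast
  have "S \<subseteq> N"
  proof
    fix s assume s: "s \<in> S"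
    then have "s = inv u \<otimes> (u \<otimes> s)"
      using un S(2) u(1) by (simp add: m_assoc[symmetric] subset_iff)
    then show "s \<in> N" using ideal.I_l_closed[OF N u(3)[OF s] Units_inv_closed[OF un]] by simp
  qed
  then show ?thesis by (rule genideal_minimal[OF N])
qed

section \<open>Homogeneous components and the graded Nakayama lemma\<close>

context standard_graded_algebra
begin

lemma A_carrier: "x \<in> A i \<Longrightarrow> x \<in> carrier R"
  using additive_subgroup.a_Hcarr[OF component_subgroup] .

lemma A_zero: "\<zero> \<in> A i"
  using additive_subgroup.zero_closed[OF component_subgroup] .

text \<open>
  The family of homogeneous components of \<open>x\<close>. It turns \<open>R\<close> into a subring of the polynomial ring
  \<open>R[t]\<close>, by \<open>x \<mapsto> \<Sum> x\<^sub>i t\<^sup>i\<close>, which is why products of components are given by convolution.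
\<close>

definition component :: "'a \<Rightarrow> nat \<Rightarrow> 'a" where
  "component x = (THE a. (\<forall>i. a i \<in> A i) \<and> finite {i. a i \<noteq> \<zero>}
     \<and> x = (\<Oplus>i\<in>{i. a i \<noteq> \<zero>}. a i))"

lemma finsum_support:
  assumes "\<And>i. a i \<in> carrier R" "bound \<zero> n a"
  shows "(\<Oplus>i\<in>{i. a i \<noteq> \<zero>}. a i) = (\<Oplus>i\<in>{..n}. a i)" "finite {i. a i \<noteq> \<zero>}"
proof -
  have sub: "{i. a i \<noteq> \<zero>} \<subseteq> {..n}" using bound_below[OF assms(2)] by auto
  then show "finite {i. a i \<noteq> \<zero>}" by (rule finite_subset) simp
  show "(\<Oplus>i\<in>{i. a i \<noteq> \<zero>}. a i) = (\<Oplus>i\<in>{..n}. a i)"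
    by (rule add.finprod_mono_neutral_cong_left) (use sub assms(1) in auto)
qed

lemma component_props:
  assumes "x \<in> carrier R"
  shows "component x i \<in> A i" "finite {i. component x i \<noteq> \<zero>}"
    "x = (\<Oplus>i\<in>{i. component x i \<noteq> \<zero>}. component x i)"
  using theI'[OF direct_sum[OF assms], folded component_def] by blast+

lemma component_carrier: "x \<in> carrier R \<Longrightarrow> component x i \<in> carrier R"
  using component_props(1) A_carrier by blast

lemma component_bound:
  assumes "x \<in> carrier R"
  obtains n where "bound \<zero> n (component x)" "x = (\<Oplus>i\<in>{..n}. component x i)"
proof -
  obtain n where "\<forall>i\<in>{i. component x i \<noteq> \<zero>}. i \<le> n"
    using component_props(2)[OF assms] finite_nat_set_iff_bounded_le by blast
  then have b: "bound \<zero> n (component x)"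
    using not_le by (intro bound.intro) auto
  then show thesis
    using that[OF b] finsum_support(1)[OF component_carrier[OF assms] b] component_props(3)[OF assms]
    by simp
qed

lemma component_unique:
  assumes a: "\<And>i. a i \<in> A i" and b: "bound \<zero> n a" and x: "x = (\<Oplus>i\<in>{..n}. a i)"
  shows "component x = a"
proof -
  have carr: "a i \<in> carrier R" for i using a A_carrier by blast
  then have xc: "x \<in> carrier R" unfolding x by simp
  show ?thesis
    unfolding component_def
    by (rule the1_equality[OF direct_sum[OF xc]])
      (use a finsum_support[OF carr b] x in auto)
qed

lemma component_homogeneous:
  assumes "x \<in> A d"
  shows "component x = (\<lambda>i. if i = d then x else \<zero>)"
proof (rule component_unique[where n = d])
  show "(if i = d then x else \<zero>) \<in> A i" for i using assms A_zero by auto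
  show "x = (\<Oplus>i\<in>{..d}. if i = d then x else \<zero>)"
    using finsum_singleton[of d "{..d}" "\<lambda>_. x"] A_carrier[OF assms]
    by (simp add: eq_commute[of _ d])
qed auto

lemma component_add:
  assumes "x \<in> carrier R" "y \<in> carrier R"
  shows "component (x \<oplus> y) i = component x i \<oplus> component y i"
proof -
  obtain n where n: "bound \<zero> n (component x)" "x = (\<Oplus>i\<in>{..n}. component x i)"
    using component_bound[OF assms(1)] .
  obtain m where m: "bound \<zero> m (component y)" "y = (\<Oplus>i\<in>{..m}. component y i)"
    using component_bound[OF assms(2)] .
  have ext: "z = (\<Oplus>i\<in>{..max n m}. component z i)"
    if "z \<in> carrier R" "bound \<zero> (max n m) (component z)" for z
    using component_props(3)[OF that(1)] finsum_support(1)[OF component_carrier[OF that(1)] that(2)] by simp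
  have bn: "bound \<zero> (max n m) (component x)" and bm: "bound \<zero> (max n m) (component y)"
    using n(1) m(1) by (auto simp: bound_def)
  have "component (x \<oplus> y) = (\<lambda>i. component x i \<oplus> component y i)"
  proof (rule component_unique)
    show "component x i \<oplus> component y i \<in> A i" for i
      using component_props(1)[OF assms(1)] component_props(1)[OF assms(2)]
        additive_subgroup.a_closed[OF component_subgroup] by blast
    show "bound \<zero> (max n m) (\<lambda>i. component x i \<oplus> component y i)"
      using bn bm by (auto simp: bound_def)
    have "(\<Oplus>i\<in>{..max n m}. component x i \<oplus> component y i)
        = (\<Oplus>i\<in>{..max n m}. component x i) \<oplus> (\<Oplus>i\<in>{..max n m}. component y i)"
      using component_carrier assms by (intro finsum_addf) auto
    then show "x \<oplus> y = (\<Oplus>i\<in>{..max n m}. component x i \<oplus> component y i)"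
      using ext[OF assms(1) bn] ext[OF assms(2) bm] by simp
  qed
  then show ?thesis by simp
qed

lemma component_times:
  assumes "x \<in> carrier R" "y \<in> carrier R"
  shows "component (x \<otimes> y) k = (\<Oplus>i\<in>{..k}. component x i \<otimes> component y (k - i))"
proof -
  obtain n where n: "bound \<zero> n (component x)" "x = (\<Oplus>i\<in>{..n}. component x i)"
    using component_bound[OF assms(1)] .
  obtain m where m: "bound \<zero> m (component y)" "y = (\<Oplus>i\<in>{..m}. component y i)"
    using component_bound[OF assms(2)] .
  have cx: "component x i \<in> carrier R" and cy: "component y i \<in> carrier R" for i
    using component_carrier assms by auto
  have "component (x \<otimes> y) = (\<lambda>k. \<Oplus>i\<in>{..k}. component x i \<otimes> component y (k - i))"
  proof (rule component_unique)
    fix k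
    show "(\<Oplus>i\<in>{..k}. component x i \<otimes> component y (k - i)) \<in> A k"
    proof -
      have "component x i \<otimes> component y (k - i) \<in> A k" if "i \<le> k" for i
        using component_mult[OF component_props(1)[OF assms(1)] component_props(1)[OF assms(2)], of i "k - i"]
          that by simp
      then show ?thesis by (intro finsum_in_additive_subgroup[OF component_subgroup]) auto
    qed
  next
    show "bound \<zero> (n + m) (\<lambda>k. \<Oplus>i\<in>{..k}. component x i \<otimes> component y (k - i))"
    proof
      fix k assume k: "n + m < k"
      have "component x i \<otimes> component y (k - i) = \<zero>" for i
      proof (cases "n < i")
        case True
        then show ?thesis using bound.bound[OF n(1)] cy by simp
      next
        case False
        then have "m < k - i" using k by linarith
        then show ?thesis using bound.bound[OF m(1)] cx by simp
      qed
      then show "(\<Oplus>i\<in>{..k}. component x i \<otimes> component y (k - i)) = \<zero>" by simp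
    qed
    show "x \<otimes> y = (\<Oplus>k\<in>{..n + m}. \<Oplus>i\<in>{..k}. component x i \<otimes> component y (k - i))"
      using cauchy_product[OF n(1) m(1)] n(2) m(2) cx cy by simp
  qed
  then show ?thesis by simp
qed

lemma one_in_A0: "\<one> \<in> A 0"
  using subringE(3)[OF subfieldE(1)[OF base_field]] .

lemma component_minus:
  assumes "x \<in> carrier R"
  shows "component (\<ominus> x) i = \<ominus> component x i"
proof -
  have "component (x \<oplus> \<ominus> x) i = \<zero>"
    using component_homogeneous[OF A_zero[of 0]] assms by (simp add: r_neg)
  then have "component x i \<oplus> component (\<ominus> x) i = \<zero>"
    using component_add[of x "\<ominus> x" i] assms by simp
  then show ?thesis using component_carrier assms
    by (metis a_inv_closed a_comm minus_equality)
qed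

lemma component_0_ideal: "ideal {x \<in> carrier R. component x 0 = \<zero>} R" (is "ideal ?M R")
proof (rule idealI[OF ring_axioms])
  show "subgroup ?M (add_monoid R)"
    using component_homogeneous[OF A_zero[of 0]]
    by (intro add.subgroupI) (auto simp: component_add component_minus intro!: exI[of _ \<zero>])
  fix a x assume a: "a \<in> ?M" and x: "x \<in> carrier R"
  then show "x \<otimes> a \<in> ?M" using component_carrier by (simp add: component_times)
  then show "a \<otimes> x \<in> ?M" using a x by (simp add: m_comm)
qed

text \<open>
  As the kernel of the projection to the field \<open>A\<^sub>0\<close>, the graded maximal ideal is visibly maximal, and
  membership in it can be tested on a single component.
\<close>

lemma graded_maximal_ideal_eq: "graded_maximal_ideal R A = {x \<in> carrier R. component x 0 = \<zero>}"
proof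
  let ?H = "\<Union>i\<in>{1..}. A i"
  have H: "?H \<subseteq> carrier R" using A_carrier by blast
  have iH: "ideal (Idl ?H) R" by (rule genideal_ideal[OF H])
  show "graded_maximal_ideal R A \<subseteq> {x \<in> carrier R. component x 0 = \<zero>}"
    unfolding graded_maximal_ideal_def
    by (rule genideal_minimal[OF component_0_ideal]) (auto simp: component_homogeneous A_carrier)
  show "{x \<in> carrier R. component x 0 = \<zero>} \<subseteq> graded_maximal_ideal R A"
  proof
    fix x assume x: "x \<in> {x \<in> carrier R. component x 0 = \<zero>}"
    then have xc: "x \<in> carrier R" by simp
    have mem: "component x i \<in> Idl ?H" for i
    proof (cases "i = 0")
      case True
      then show ?thesis using x additive_subgroup.zero_closed[OF ideal.axioms(1)[OF iH]] by simp
    next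
      case False
      then have "component x i \<in> ?H" using component_props(1)[OF xc, of i] by (auto intro!: bexI[of _ i])
      then show ?thesis using genideal_self[OF H] by blast
    qed
    obtain n where n: "x = (\<Oplus>i\<in>{..n}. component x i)" using component_bound[OF xc] by metis
    have "(\<Oplus>i\<in>{..n}. component x i) \<in> Idl ?H"
      by (intro finsum_in_additive_subgroup[OF ideal.axioms(1)[OF iH]] mem) simp
    then show "x \<in> graded_maximal_ideal R A"
      unfolding graded_maximal_ideal_def using n by metis
  qed
qed

lemma maximalideal_graded_maximal_ideal: "maximalideal (graded_maximal_ideal R A) R"
proof (rule maximalidealI)
  let ?M = "graded_maximal_ideal R A"
  show iM: "ideal ?M R" unfolding graded_maximal_ideal_eq by (rule component_0_ideal)
  have "\<one> \<notin> ?M"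
    using subfieldE(6)[OF base_field] unfolding graded_maximal_ideal_eq
    by (simp add: component_homogeneous[OF one_in_A0])
  then show "carrier R \<noteq> ?M" using one_closed by metis
  fix J assume J: "ideal J R" "?M \<subseteq> J" "J \<subseteq> carrier R"
  show "J = ?M \<or> J = carrier R"
  proof (cases "J \<subseteq> ?M")
    case False
    then obtain x where x: "x \<in> J" "x \<notin> ?M" by blast
    then have xc: "x \<in> carrier R" using J(3) by blast
    define c where "c = component x 0"
    have c: "c \<in> A 0" "c \<noteq> \<zero>" "c \<in> carrier R"
      using component_props(1)[OF xc, of 0] component_carrier[OF xc] x xc
      unfolding graded_maximal_ideal_eq c_def by auto
    have "component (x \<oplus> \<ominus> c) 0 = \<zero>"
      using c xc component_homogeneous[OF c(1)]
      by (simp add: component_add component_minus c_def[symmetric] r_neg)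
    then have "x \<oplus> \<ominus> c \<in> J" using J(2) c xc unfolding graded_maximal_ideal_eq by auto
    then have "x \<oplus> \<ominus> (x \<oplus> \<ominus> c) \<in> J"
      using x(1) J(1) by (meson additive_subgroup.a_closed additive_subgroup.a_inv_closed ideal.axioms(1))
    moreover have "x \<oplus> \<ominus> (x \<oplus> \<ominus> c) = c" using xc c by algebra
    ultimately have "c \<in> J" by simp
    moreover have "inv c \<in> carrier R" "inv c \<otimes> c = \<one>"
      using subfield_m_inv[OF base_field, of c] c A_carrier by auto
    ultimately have "\<one> \<in> J" using ideal.I_l_closed[OF J(1)] by metis
    then show ?thesis using ideal.one_imp_carrier[OF J(1)] by blast
  qed (use J(2) in blast)
qed

text \<open>
  An ideal with homogeneous generators is graded: the elements whose components all lie in it form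
  an ideal that contains the generators.
\<close>

lemma component_in_genideal:
  assumes T: "T \<subseteq> (\<Union>i. A i)" and x: "x \<in> Idl T"
  shows "component x i \<in> Idl T"
proof -
  have Tc: "T \<subseteq> carrier R" using T A_carrier by blast
  interpret T: ideal "Idl T" R by (rule genideal_ideal[OF Tc])
  let ?J = "{x \<in> carrier R. \<forall>i. component x i \<in> Idl T}"
  have "ideal ?J R"
  proof (rule idealI[OF ring_axioms])
    show "subgroup ?J (add_monoid R)"
      using component_homogeneous[OF A_zero[of 0]]
      by (intro add.subgroupI) (auto simp: component_add component_minus intro!: exI[of _ \<zero>])
    fix a x assume a: "a \<in> ?J" and x: "x \<in> carrier R"
    have "(\<Oplus>i\<in>{..k}. component x i \<otimes> component a (k - i)) \<in> Idl T" for k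
      by (rule finsum_in_additive_subgroup[OF T.is_additive_subgroup])
        (use a x component_carrier T.I_l_closed in auto)
    then show "x \<otimes> a \<in> ?J" using a x by (simp add: component_times)
    then show "a \<otimes> x \<in> ?J" using a x by (simp add: m_comm)
  qed
  moreover have "T \<subseteq> ?J"
  proof
    fix t assume t: "t \<in> T"
    then obtain d where "t \<in> A d" using T by blast
    then have "component t i \<in> Idl T" for i
      using t genideal_self[OF Tc] by (auto simp: component_homogeneous)
    then show "t \<in> ?J" using t Tc by blast
  qed
  ultimately have "Idl T \<subseteq> ?J" by (rule genideal_minimal)
  then show ?thesis using x by blast
qed

text \<open>
  Of the multiplier \<open>u\<close> from \<open>nakayama\<close> only the component of degree \<open>0\<close> matters here, and it equals \<open>1\<close>:
  a homogeneous element \<open>s\<close> is a component of \<open>us\<close>.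
\<close>

lemma nakayama_graded:
  assumes S: "finite S" "S \<subseteq> (\<Union>i. A i)" and T: "T \<subseteq> (\<Union>i. A i)"
    and cover: "Idl S \<subseteq> Idl T <+>\<^bsub>R\<^esub> graded_maximal_ideal R A \<cdot> (Idl S)"
  shows "Idl S \<subseteq> Idl T"
proof -
  have Sc: "S \<subseteq> carrier R" and Tc: "T \<subseteq> carrier R" using S T A_carrier by blast+
  have iT: "ideal (Idl T) R" by (rule genideal_ideal[OF Tc])
  have iM: "ideal (graded_maximal_ideal R A) R"
    using maximalideal_graded_maximal_ideal by (simp add: maximalideal_def)
  obtain u where u: "u \<in> carrier R" "u \<ominus> \<one> \<in> graded_maximal_ideal R A" "\<And>s. s \<in> S \<Longrightarrow> u \<otimes> s \<in> Idl T"
    using nakayama[OF iM iT S(1) Sc] cover genideal_self[OF Sc] by blast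
  have "component (u \<ominus> \<one>) 0 = \<zero>" using u(2) unfolding graded_maximal_ideal_eq by simp
  moreover have "component (u \<ominus> \<one>) 0 = component u 0 \<ominus> \<one>"
    using u(1) by (simp add: minus_eq component_add component_minus component_homogeneous[OF one_in_A0])
  ultimately have u0: "component u 0 = \<one>"
    using component_carrier[OF u(1), of 0] by (simp add: r_right_minus_eq)
  have "S \<subseteq> Idl T"
  proof
    fix s assume s: "s \<in> S"
    then obtain d where d: "s \<in> A d" using S(2) by blast
    then have sc: "s \<in> carrier R" by (rule A_carrier)
    have "component (s \<otimes> u) d = (\<Oplus>i\<in>{..d}. component s i \<otimes> component u (d - i))"
      by (rule component_times[OF sc u(1)])
    also have "\<dots> = (\<Oplus>i\<in>{..d}. if i = d then s else \<zero>)"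
      using component_carrier[OF u(1)] sc u0
      by (intro finsum_cong') (auto simp: component_homogeneous[OF d])
    also have "\<dots> = s"
      using finsum_singleton[of d "{..d}" "\<lambda>_. s"] sc by (simp add: eq_commute[of _ d])
    finally have "component (s \<otimes> u) d = s" .
    moreover have "s \<otimes> u \<in> Idl T" using u(3)[OF s] m_comm[OF sc u(1)] by simp
    ultimately show "s \<in> Idl T" using component_in_genideal[OF T] by metis
  qed
  then show ?thesis by (rule genideal_minimal[OF iT])
qed

lemma homogeneous_generators:
  assumes I: "graded_ideal R A I"
  shows "\<exists>S. finite S \<and> S \<subseteq> (\<Union>i. A i) \<and> Idl S = I"
proof -
  interpret N: noetherian_ring R by (rule standard_graded_algebra_is_noetherian)
  let ?H = "I \<inter> (\<Union>i. A i)"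
  have iI: "ideal I R" and gen: "I = Idl ?H" using I by (auto simp: graded_ideal_def)
  obtain F where F: "F \<subseteq> carrier R" "finite F" "I = Idl F" using N.finetely_gen[OF iI] by blast
  have "F \<subseteq> Idl ?H" using genideal_self[OF F(1)] F(3) gen by blast
  then obtain S where S: "finite S" "S \<subseteq> ?H" "F \<subseteq> Idl S"
    using finite_subset_genideal[OF _ F(2), of ?H] A_carrier by blast
  have "S \<subseteq> carrier R" using S(2) A_carrier by blast
  then have "I \<subseteq> Idl S" unfolding F(3) using S(3) by (intro genideal_minimal genideal_ideal)
  moreover have "Idl S \<subseteq> I" using S(2) by (intro genideal_minimal[OF iI]) auto
  ultimately show ?thesis using S by blast
qed

text \<open>
  The powers of a graded ideal inherit finite homogeneous generating sets, namely the products of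
  generators.
\<close>

lemma homogeneous_generators_pow:
  assumes S: "finite S" "S \<subseteq> (\<Union>i. A i)"
  shows "\<exists>T. finite T \<and> T \<subseteq> (\<Union>i. A i) \<and> Idl T = ideal_pow R (Idl S) k"
proof (induction k)
  case 0
  have "Idl {\<one>} = ideal_pow R (Idl S) 0" by (simp add: genideal_one ideals_set_def)
  then show ?case using one_in_A0 by (intro exI[of _ "{\<one>}"]) auto
next
  case (Suc k)
  then obtain T where T: "finite T" "T \<subseteq> (\<Union>i. A i)" "Idl T = ideal_pow R (Idl S) k" by blast
  have Sc: "S \<subseteq> carrier R" and Tc: "T \<subseteq> carrier R" using S T A_carrier by blast+
  have "Idl (T <#> S) = ideal_pow R (Idl S) (Suc k)"
    using ideal_prod_genideal[OF Tc Sc] T(3) by (simp add: ideals_set_def)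
  moreover have "finite (T <#> S)" using S T by (auto simp: set_mult_def)
  moreover have "T <#> S \<subseteq> (\<Union>i. A i)"
  proof
    fix x assume "x \<in> T <#> S"
    then obtain t s where x: "t \<in> T" "s \<in> S" "x = t \<otimes> s" unfolding set_mult_def by blast
    then obtain i j where "t \<in> A i" "s \<in> A j" using S(2) T(2) by blast
    then show "x \<in> (\<Union>i. A i)" using component_mult x(3) by blast
  qed
  ultimately show ?case by blast
qed

end

section \<open>The fiber ring\<close>

lemma (in ring) UP_is_ring: "ring (UP R)"
proof -
  interpret P: UP_ring R "UP R" by unfold_locales
  show ?thesis by (rule P.UP_ring)
qed

lemma (in cring) UP_a_inv_apply:
  assumes "p \<in> carrier (UP R)"
  shows "(\<ominus>\<^bsub>UP R\<^esub> p) k = \<ominus> p k"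
proof -
  interpret P: UP_cring R "UP R" by unfold_locales
  have "\<ominus>\<^bsub>UP R\<^esub> p \<in> carrier (UP R)"
    by (rule ring.ring_simprules(3)[OF P.UP_ring assms])
  then have "up_ring.coeff (UP R) (\<ominus>\<^bsub>UP R\<^esub> p) k = (\<ominus>\<^bsub>UP R\<^esub> p) k" "up_ring.coeff (UP R) p k = p k"
    using assms by (simp_all only: UP_def up_ring.simps partial_object.simps restrict_apply' if_True)
  then show ?thesis using P.coeff_a_inv[OF assms, of k] by simp
qed

text \<open>
  Monomials of \<open>R[t]\<close> serve to place an element of \<open>I\<^sup>k\<close> into degree \<open>k\<close> of the Rees algebra.
\<close>

lemma (in cring) UP_monom:
  assumes "a \<in> carrier R"
  shows "up_ring.monom (UP R) a k \<in> carrier (UP R)"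
    and "up_ring.monom (UP R) a k = (\<lambda>i. if i = k then a else \<zero>)"
    and "b \<in> carrier R \<Longrightarrow> up_ring.monom (UP R) (a \<oplus> b) k
      = up_ring.monom (UP R) a k \<oplus>\<^bsub>UP R\<^esub> up_ring.monom (UP R) b k"
    and "b \<in> carrier R \<Longrightarrow> up_ring.monom (UP R) (a \<otimes> b) (k + j)
      = up_ring.monom (UP R) a k \<otimes>\<^bsub>UP R\<^esub> up_ring.monom (UP R) b j"
proof -
  interpret P: UP_cring R "UP R" by unfold_locales
  show "up_ring.monom (UP R) a k \<in> carrier (UP R)" using assms by (rule P.monom_closed)
  show "up_ring.monom (UP R) a k = (\<lambda>i. if i = k then a else \<zero>)"
    using assms by (simp only: UP_def up_ring.simps restrict_apply' if_True)
  show "b \<in> carrier R \<Longrightarrow> up_ring.monom (UP R) (a \<oplus> b) k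
      = up_ring.monom (UP R) a k \<oplus>\<^bsub>UP R\<^esub> up_ring.monom (UP R) b k"
    using assms by (rule P.monom_add)
  show "b \<in> carrier R \<Longrightarrow> up_ring.monom (UP R) (a \<otimes> b) (k + j)
      = up_ring.monom (UP R) a k \<otimes>\<^bsub>UP R\<^esub> up_ring.monom (UP R) b j"
    using assms by (rule P.monom_mult)
qed

text \<open>
  The spanning family is indexed by \<open>f\<close> in order that a basis chosen from it can be pulled back to a
  subset of the indices; for the fiber ring these are ideal generators and \<open>f\<close> sends them to their
  classes.
\<close>

lemma (in ring) independent_subfamily:
  assumes K: "subfield K R" and "f ` set xs \<subseteq> carrier R"
  shows "\<exists>ys. set ys \<subseteq> set xs \<and> length ys \<le> length xs \<and> independent K (map f ys)
    \<and> Span K (map f ys) = Span K (map f xs)"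
  using assms(2)
proof (induction xs)
  case Nil
  then show ?case by auto
next
  case (Cons x xs)
  then obtain ys where ys: "set ys \<subseteq> set xs" "length ys \<le> length xs"
    "independent K (map f ys)" "Span K (map f ys) = Span K (map f xs)" by auto
  have carr: "set (map f xs) \<subseteq> carrier R" "f x \<in> carrier R" using Cons.prems by auto
  show ?case
  proof (cases "f x \<in> Span K (map f xs)")
    case True
    then have "set (f x # map f xs) \<subseteq> Span K (map f xs)"
      using Span_base_incl[OF K carr(1)] by auto
    then have "Span K (f x # map f xs) = Span K (map f xs)"
      using mono_Span_subset[OF K _ carr(1), of "f x # map f xs"] mono_Span[OF K carr] by blast
    then show ?thesis using ys by (intro exI[of _ ys]) auto
  next
    case False
    then have "independent K (map f (x # ys))"
      using ys carr(2) li_Cons[of "f x" K "map f ys"] by simp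
    then show ?thesis using ys by (intro exI[of _ "x # ys"]) auto
  qed
qed

text \<open>
  What the local and the graded case have in common: they differ only in the form of Nakayama's
  lemma and in the choice of generators to which it applies.
\<close>

locale fiber_data = cring R for R (structure) +
  fixes \<mm> I :: "'a set"
  assumes maximal: "maximalideal \<mm> R" and ideal_I: "ideal I R"
begin

abbreviation "I_pow \<equiv> ideal_pow R I"
abbreviation "modulus \<equiv> fiber_modulus R \<mm> I"
abbreviation "F \<equiv> fiber_ring R \<mm> I"

lemma ideal_maximal: "ideal \<mm> R"
  using maximal by (simp add: maximalideal_def)

lemma ideal_pow: "ideal (I_pow k) R"
proof -
  interpret M: comm_monoid "ideals_set R" by (rule ideals_set_is_comm_monoid)
  show ?thesis using M.nat_pow_closed[of I k] ideal_I by (simp add: ideals_set_def)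
qed

lemma ideal_modulus: "ideal (modulus k) R"
  by (intro ideal_prod_is_ideal ideal_maximal ideal_pow)

lemma pow_prod: "ideal_prod R (I_pow i) (I_pow j) = I_pow (i + j)"
proof -
  interpret M: comm_monoid "ideals_set R" by (rule ideals_set_is_comm_monoid)
  show ?thesis using M.nat_pow_mult[of I i j] ideal_I by (simp add: ideals_set_def)
qed

lemma ideals_set_one [simp]: "\<one>\<^bsub>ideals_set R\<^esub> = carrier R"
  by (simp add: ideals_set_def)

lemma pow_0: "I_pow 0 = carrier R"
  by (simp add: ideals_set_def)

lemma pow_1: "I_pow (1::nat) = I"
proof -
  interpret M: comm_monoid "ideals_set R" by (rule ideals_set_is_comm_monoid)
  have "I \<in> carrier (ideals_set R)" using ideal_I by (simp add: ideals_set_def)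
  then show ?thesis by (rule M.nat_pow_eone)
qed

lemma modulus_0: "modulus 0 = \<mm>"
  using ideal_prod_one[OF ideal_maximal] by (simp only: pow_0)

lemma pow_subset: "I_pow k \<subseteq> carrier R"
  using ideal.Icarr[OF ideal_pow] by blast

lemma pow_carrier: "x \<in> I_pow k \<Longrightarrow> x \<in> carrier R"
  using pow_subset by blast

lemma pow_mult: "a \<in> I_pow i \<Longrightarrow> b \<in> I_pow j \<Longrightarrow> a \<otimes> b \<in> I_pow (i + j)"
  using pow_prod[of i j] ideal_prod.prod[of a "I_pow i" b "I_pow j" R] by simp

lemma modulus_subset_pow: "modulus k \<subseteq> I_pow k"
  using ideal_prod_inter[OF ideal_maximal ideal_pow] by blast

lemma modulus_mult: "x \<in> modulus i \<Longrightarrow> b \<in> I_pow j \<Longrightarrow> x \<otimes> b \<in> modulus (i + j)"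
  using ideal_prod_assoc[OF ideal_maximal ideal_pow ideal_pow, of i j]
    ideal_prod.prod[of x "modulus i" b "I_pow j" R] by (simp add: pow_prod)

lemma modulus_mult': "b \<in> I_pow i \<Longrightarrow> x \<in> modulus j \<Longrightarrow> b \<otimes> x \<in> modulus (i + j)"
  using modulus_mult[of x j b i] m_comm[of b x] pow_subset modulus_subset_pow
  by (metis add.commute subsetD)

lemma coset_eq_iff:
  assumes "a \<in> carrier R" "b \<in> carrier R"
  shows "modulus k +> a = modulus k +> b \<longleftrightarrow> a \<ominus> b \<in> modulus k"
  using quotient_eq_iff_same_a_r_cos[OF ideal_modulus assms] by simp

text \<open>
  The product of cosets of different moduli is well defined because \<open>\<mm>I\<^sup>i \<cdot> I\<^sup>j\<close> and \<open>I\<^sup>i \<cdot> \<mm>I\<^sup>j\<close> are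
  contained in \<open>\<mm>I\<^sup>i\<^sup>+\<^sup>j\<close>.
\<close>

lemma rcoset_mult_graded:
  assumes a: "a \<in> I_pow i" and b: "b \<in> I_pow j"
  shows "rcoset_mult R (modulus (i + j)) (modulus i +> a) (modulus j +> b)
    = modulus (i + j) +> (a \<otimes> b)"
proof -
  have aR: "a \<in> carrier R" and bR: "b \<in> carrier R" using a b pow_subset by auto
  have eq: "modulus (i + j) +> (a' \<otimes> b') = modulus (i + j) +> (a \<otimes> b)"
    if a'b': "a' \<in> modulus i +> a" "b' \<in> modulus j +> b" for a' b'
  proof -
    obtain x y where x: "x \<in> modulus i" "a' = x \<oplus> a" and y: "y \<in> modulus j" "b' = y \<oplus> b"
      using a'b' unfolding a_r_coset_def' by blast
    have c: "x \<in> carrier R" "y \<in> carrier R"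
      using x y ideal.Icarr[OF ideal_modulus] by auto
    have "(x \<oplus> a) \<otimes> (y \<oplus> b) \<ominus> a \<otimes> b = (x \<otimes> y \<oplus> x \<otimes> b) \<oplus> a \<otimes> y"
      using c aR bR by algebra
    moreover have "x \<otimes> y \<in> modulus (i + j)" "x \<otimes> b \<in> modulus (i + j)" "a \<otimes> y \<in> modulus (i + j)"
      using x y a b modulus_subset_pow by (auto intro: modulus_mult modulus_mult')
    ultimately have "a' \<otimes> b' \<ominus> a \<otimes> b \<in> modulus (i + j)"
      using x y ideal.axioms(1)[OF ideal_modulus] by (simp add: additive_subgroup.a_closed)
    then show ?thesis using coset_eq_iff[of "a' \<otimes> b'" "a \<otimes> b"] c x y aR bR by simp
  qed
  have "a \<in> modulus i +> a" "b \<in> modulus j +> b"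
    using abelian_subgroup.a_rcos_self[OF abelian_subgroupI3[OF ideal.axioms(1)[OF ideal_modulus] is_abelian_group]] aR bR
    by blast+
  with eq show ?thesis unfolding rcoset_mult_def by blast
qed

text \<open>
  The Rees algebra \<open>R[It]\<close>, of which the fiber ring is the reduction modulo \<open>\<mm>\<close>.
\<close>

definition Rees :: "(nat \<Rightarrow> 'a) set" where
  "Rees = {p \<in> carrier (UP R). \<forall>k. p k \<in> I_pow k}"

definition fiber_class :: "(nat \<Rightarrow> 'a) \<Rightarrow> nat \<Rightarrow> 'a set" where
  "fiber_class p = (\<lambda>k. modulus k +> p k)"

lemma up_apply:
  assumes "p \<in> carrier (UP R)" "q \<in> carrier (UP R)"
  shows "(p \<otimes>\<^bsub>UP R\<^esub> q) k = (\<Oplus>i\<in>{..k}. p i \<otimes> q (k - i))"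
    and "(p \<oplus>\<^bsub>UP R\<^esub> q) k = p k \<oplus> q k"
  using assms by (simp_all add: UP_def)

lemma Rees_subring: "subring Rees (UP R)"
proof (rule ring.subringI[OF UP_is_ring])
  show "Rees \<subseteq> carrier (UP R)" by (auto simp: Rees_def)
  show "\<one>\<^bsub>UP R\<^esub> \<in> Rees"
    using additive_subgroup.zero_closed[OF ideal.axioms(1)[OF ideal_pow]]
    by (auto simp: Rees_def) (auto simp: UP_def up_one_closed)
  fix p q assume p: "p \<in> Rees" and q: "q \<in> Rees"
  then have pc: "p \<in> carrier (UP R)" and qc: "q \<in> carrier (UP R)" by (auto simp: Rees_def)
  show "p \<oplus>\<^bsub>UP R\<^esub> q \<in> Rees"
    using p q additive_subgroup.a_closed[OF ideal.axioms(1)[OF ideal_pow]]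
      ring.ring_simprules(1)[OF UP_is_ring pc qc]
    by (auto simp: Rees_def up_apply)
  show "p \<otimes>\<^bsub>UP R\<^esub> q \<in> Rees"
  proof -
    have "(\<Oplus>i\<in>{..k}. p i \<otimes> q (k - i)) \<in> I_pow k" for k
    proof (rule finsum_in_additive_subgroup[OF ideal.axioms(1)[OF ideal_pow]])
      fix i assume "i \<in> {..k}"
      then show "p i \<otimes> q (k - i) \<in> I_pow k"
        using pow_mult[of "p i" i "q (k - i)" "k - i"] p q by (simp add: Rees_def)
    qed simp
    then show ?thesis using pc qc ring.ring_simprules(5)[OF UP_is_ring pc qc]
      by (simp add: Rees_def up_apply)
  qed
next
  fix p assume p: "p \<in> Rees"
  then have pc: "p \<in> carrier (UP R)" by (auto simp: Rees_def)
  note eq = UP_a_inv_apply[OF pc]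
  show "\<ominus>\<^bsub>UP R\<^esub> p \<in> Rees"
    using p additive_subgroup.a_inv_closed[OF ideal.axioms(1)[OF ideal_pow]]
      ring.ring_simprules(3)[OF UP_is_ring pc]
    by (auto simp: Rees_def eq)
qed

lemma Rees_ring: "ring (UP R\<lparr>carrier := Rees\<rparr>)"
  by (rule ring.subring_is_ring[OF UP_is_ring Rees_subring])

lemma coset_add:
  assumes "a \<in> carrier R" "b \<in> carrier R"
  shows "(modulus k +> a) \<oplus>\<^bsub>R Quot modulus k\<^esub> (modulus k +> b) = modulus k +> (a \<oplus> b)"
  using ideal.a_rcos_sum[OF ideal_modulus assms] by (simp add: FactRing_def)

lemma coset_zero: "modulus k +> \<zero> = modulus k"
  using a_rcos_zero[OF ideal_modulus additive_subgroup.zero_closed[OF ideal.axioms(1)[OF ideal_modulus]]] .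

lemma Rees_carrier: "p \<in> Rees \<Longrightarrow> p k \<in> carrier R"
  using pow_subset by (auto simp: Rees_def)

lemma ReesI:
  assumes "\<And>k. p k \<in> I_pow k" "finite {k. p k \<noteq> \<zero>}"
  shows "p \<in> Rees"
proof -
  obtain n where n: "\<And>k. p k \<noteq> \<zero> \<Longrightarrow> k \<le> n"
    using assms(2) by (metis (mono_tags, lifting) finite_nat_set_iff_bounded_le mem_Collect_eq)
  have "bound \<zero> n p" using n by (metis bound.intro not_le)
  then show ?thesis using assms(1) pow_subset by (auto simp: Rees_def UP_def up_def)
qed

lemma Rees_finite_support:
  assumes "p \<in> Rees" shows "finite {k. p k \<noteq> \<zero>}"
proof -
  obtain n where "bound \<zero> n p" using assms by (auto simp: Rees_def UP_def up_def)
  then have "{k. p k \<noteq> \<zero>} \<subseteq> {..n}" by (auto intro: bound_below)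
  then show ?thesis using finite_subset by blast
qed

text \<open>
  An element of the fiber ring has almost all of its components equal to zero; lifting these to
  \<open>\<zero>\<close> gives a polynomial.
\<close>

lemma fiber_class_image: "fiber_class ` Rees = carrier F"
proof
  show "fiber_class ` Rees \<subseteq> carrier F"
  proof
    fix f assume "f \<in> fiber_class ` Rees"
    then obtain p where p: "p \<in> Rees" "f = fiber_class p" by blast
    have "{k. f k \<noteq> modulus k} \<subseteq> {k. p k \<noteq> \<zero>}"
      using p coset_zero by (auto simp: fiber_class_def)
    then show "f \<in> carrier F"
      using Rees_finite_support[OF p(1)] p finite_subset
      by (auto simp: fiber_ring_def fiber_class_def Rees_def)
  qed
  show "carrier F \<subseteq> fiber_class ` Rees"
  proof
    fix f assume f: "f \<in> carrier F"
    have "\<forall>k. \<exists>a. a \<in> I_pow k \<and> f k = modulus k +> a \<and> (f k = modulus k \<longrightarrow> a = \<zero>)"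
    proof
      fix k
      obtain a where "a \<in> I_pow k" "f k = modulus k +> a"
        using f by (auto simp: fiber_ring_def)
      then show "\<exists>a. a \<in> I_pow k \<and> f k = modulus k +> a \<and> (f k = modulus k \<longrightarrow> a = \<zero>)"
        using coset_zero additive_subgroup.zero_closed[OF ideal.axioms(1)[OF ideal_pow]]
        by (cases "f k = modulus k") (auto intro: exI[of _ \<zero>] exI[of _ a])
    qed
    then obtain p where p: "\<And>k. p k \<in> I_pow k" "\<And>k. f k = modulus k +> p k"
      "\<And>k. f k = modulus k \<Longrightarrow> p k = \<zero>" by metis
    have "{k. p k \<noteq> \<zero>} \<subseteq> {k. f k \<noteq> modulus k}" using p(3) by auto
    moreover have "finite {k. f k \<noteq> modulus k}" using f by (simp add: fiber_ring_def)
    ultimately have "p \<in> Rees" using p(1) ReesI finite_subset by blast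
    then show "f \<in> fiber_class ` Rees" using p(2) by (auto simp: fiber_class_def)
  qed
qed

lemma fiber_class_hom: "fiber_class \<in> ring_hom (UP R\<lparr>carrier := Rees\<rparr>) F"
proof (rule ring_hom_memI)
  fix p assume "p \<in> carrier (UP R\<lparr>carrier := Rees\<rparr>)"
  then show "fiber_class p \<in> carrier F" using fiber_class_image by auto
next
  fix p q assume "p \<in> carrier (UP R\<lparr>carrier := Rees\<rparr>)" "q \<in> carrier (UP R\<lparr>carrier := Rees\<rparr>)"
  then have p: "p \<in> Rees" and q: "q \<in> Rees" by auto
  then have pc: "p \<in> carrier (UP R)" and qc: "q \<in> carrier (UP R)" by (auto simp: Rees_def)
  have sum: "fiber_class (p \<oplus>\<^bsub>UP R\<^esub> q) = fiber_class p \<oplus>\<^bsub>F\<^esub> fiber_class q"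
    using Rees_carrier p q by (auto simp: fiber_class_def fiber_ring_def up_apply[OF pc qc] coset_add)
  then show "fiber_class (p \<oplus>\<^bsub>UP R\<lparr>carrier := Rees\<rparr>\<^esub> q) = fiber_class p \<oplus>\<^bsub>F\<^esub> fiber_class q" by simp
  have "(fiber_class p \<otimes>\<^bsub>F\<^esub> fiber_class q) k = fiber_class (p \<otimes>\<^bsub>UP R\<^esub> q) k" for k
  proof -
    interpret Q: ring_hom_cring R "R Quot modulus k" "(+>) (modulus k)"
      by (rule ideal.rcos_ring_hom_cring[OF ideal_modulus]) (rule cring_axioms)
    have eq: "rcoset_mult R (modulus k) (modulus i +> p i) (modulus (k - i) +> q (k - i))
        = modulus k +> (p i \<otimes> q (k - i))" if "i \<le> k" for i
      using rcoset_mult_graded[of "p i" i "q (k - i)" "k - i"] p q that by (simp add: Rees_def)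
    have "(fiber_class p \<otimes>\<^bsub>F\<^esub> fiber_class q) k
        = (\<Oplus>\<^bsub>R Quot modulus k\<^esub>i\<in>{..k}. modulus k +> (p i \<otimes> q (k - i)))"
      unfolding fiber_ring_def fiber_class_def
      by (simp, rule Q.S.finsum_cong') (use Rees_carrier p q in \<open>auto simp: eq\<close>)
    also have "\<dots> = modulus k +> (\<Oplus>i\<in>{..k}. p i \<otimes> q (k - i))"
      using Rees_carrier p q by (subst Q.hom_finsum) (auto simp: o_def)
    finally show ?thesis using pc qc by (simp add: fiber_class_def up_apply)
  qed
  then show "fiber_class (p \<otimes>\<^bsub>UP R\<lparr>carrier := Rees\<rparr>\<^esub> q) = fiber_class p \<otimes>\<^bsub>F\<^esub> fiber_class q"
    by auto
next
  show "fiber_class \<one>\<^bsub>UP R\<lparr>carrier := Rees\<rparr>\<^esub> = \<one>\<^bsub>F\<^esub>"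
    by (rule ext) (simp add: fiber_class_def fiber_ring_def UP_def coset_zero)
qed

lemma fiber_class_zero: "fiber_class \<zero>\<^bsub>UP R\<^esub> = \<zero>\<^bsub>F\<^esub>"
  by (rule ext) (simp add: fiber_class_def fiber_ring_def UP_def coset_zero)

text \<open>
  The ring laws, such as associativity of the convolution product, are inherited from \<open>R[t]\<close> along the
  surjective homomorphism \<open>fiber_class\<close>.
\<close>

lemma fiber_ring_is_ring: "ring F"
  using ring.ring_hom_imp_img_ring[OF Rees_ring fiber_class_hom]
  by (simp add: fiber_class_image fiber_class_zero)

text \<open>
  The class of \<open>x \<in> I\<^sup>k\<close> in \<open>I\<^sup>k/\<mm>I\<^sup>k\<close>, regarded as a homogeneous element of the fiber ring.
\<close>

definition degree_class :: "nat \<Rightarrow> 'a \<Rightarrow> nat \<Rightarrow> 'a set" where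
  "degree_class k x = fiber_class (up_ring.monom (UP R) x k)"

lemma monom_in_Rees: "x \<in> I_pow k \<Longrightarrow> up_ring.monom (UP R) x k \<in> Rees"
  using UP_monom(1,2)[of x k] pow_subset[of k]
    additive_subgroup.zero_closed[OF ideal.axioms(1)[OF ideal_pow]]
  by (auto simp: Rees_def)

lemma degree_class_apply:
  "x \<in> carrier R \<Longrightarrow> degree_class k x = (\<lambda>j. if j = k then modulus k +> x else modulus j)"
  by (rule ext) (simp add: degree_class_def fiber_class_def UP_monom(2) coset_zero)

lemma degree_class_closed: "x \<in> I_pow k \<Longrightarrow> degree_class k x \<in> carrier F"
  using monom_in_Rees fiber_class_image by (auto simp: degree_class_def)

lemma degree_class_add:
  assumes "x \<in> I_pow k" "y \<in> I_pow k"
  shows "degree_class k (x \<oplus> y) = degree_class k x \<oplus>\<^bsub>F\<^esub> degree_class k y"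
  using ring_hom_add[OF fiber_class_hom, of "up_ring.monom (UP R) x k" "up_ring.monom (UP R) y k"]
    monom_in_Rees assms UP_monom(3)[of x y k]
  by (simp add: degree_class_def pow_carrier)

lemma degree_class_mult:
  assumes "x \<in> I_pow i" "y \<in> I_pow j"
  shows "degree_class (i + j) (x \<otimes> y) = degree_class i x \<otimes>\<^bsub>F\<^esub> degree_class j y"
  using ring_hom_mult[OF fiber_class_hom, of "up_ring.monom (UP R) x i" "up_ring.monom (UP R) y j"]
    monom_in_Rees assms UP_monom(4)[of x y i j]
  by (simp add: degree_class_def pow_carrier)

lemma degree_class_0_one: "degree_class 0 \<one> = \<one>\<^bsub>F\<^esub>"
  by (rule ext) (simp add: degree_class_apply fiber_ring_def)

lemma degree_class_zero: "degree_class k \<zero> = \<zero>\<^bsub>F\<^esub>"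
  by (rule ext) (simp add: degree_class_apply fiber_ring_def coset_zero)

lemma degree_class_eq_iff:
  assumes "x \<in> carrier R" "y \<in> carrier R"
  shows "degree_class k x = degree_class k y \<longleftrightarrow> x \<ominus> y \<in> modulus k"
  using assms by (auto simp: degree_class_apply fun_eq_iff coset_eq_iff[symmetric])

lemma fiber_component_eq: "fiber_component R \<mm> I k = degree_class k ` I_pow k"
proof
  show "degree_class k ` I_pow k \<subseteq> fiber_component R \<mm> I k"
  proof (rule image_subsetI)
    fix x assume "x \<in> I_pow k"
    then show "degree_class k x \<in> fiber_component R \<mm> I k"
      using degree_class_closed[of x k] degree_class_apply[OF pow_carrier, of x k]
      by (simp add: fiber_component_def)
  qed
  show "fiber_component R \<mm> I k \<subseteq> degree_class k ` I_pow k"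
  proof
    fix f assume f: "f \<in> fiber_component R \<mm> I k"
    then have "\<forall>k. \<exists>x\<in>I_pow k. f k = modulus k +> x"
      by (simp add: fiber_component_def fiber_ring_def)
    then obtain x where x: "x \<in> I_pow k" "f k = modulus k +> x" by blast
    then have "f = degree_class k x"
      using f by (simp add: fiber_component_def degree_class_apply[OF pow_carrier] fun_eq_iff)
    then show "f \<in> degree_class k ` I_pow k" using x by blast
  qed
qed

lemma invertible_mod_maximal:
  assumes "r \<in> carrier R" "r \<notin> \<mm>"
  shows "\<exists>s\<in>carrier R. r \<otimes> s \<ominus> \<one> \<in> \<mm>"
proof -
  interpret M: maximalideal \<mm> R by (rule maximal)
  interpret Q: field "R Quot \<mm>" by (rule M.quotient_is_field) (rule cring_axioms)
  have "\<mm> +> r \<in> carrier (R Quot \<mm>)" "\<mm> +> r \<noteq> \<zero>\<^bsub>R Quot \<mm>\<^esub>"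
    using assms M.rcos_const_imp_mem by (auto simp: FactRing_def A_RCOSETS_def' )
  then obtain q where q: "q \<in> carrier (R Quot \<mm>)" "(\<mm> +> r) \<otimes>\<^bsub>R Quot \<mm>\<^esub> q = \<one>\<^bsub>R Quot \<mm>\<^esub>"
    using Q.field_Units by (metis DiffI Q.Units_r_inv_ex singletonD)
  obtain s where s: "s \<in> carrier R" "q = \<mm> +> s"
    using q(1) by (auto simp: FactRing_def A_RCOSETS_def')
  have "\<mm> +> (r \<otimes> s) = \<mm> +> \<one>"
    using q(2) s assms by (simp add: FactRing_def M.rcoset_mult_add)
  then show ?thesis using quotient_eq_iff_same_a_r_cos[OF M.ideal_axioms] s assms by blast
qed

abbreviation "residue_field \<equiv> fiber_component R \<mm> I 0"

lemma residue_field_eq: "residue_field = degree_class 0 ` carrier R"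
  using fiber_component_eq[of 0] by (simp only: pow_0)

lemma degree_class_0_hom: "degree_class 0 \<in> ring_hom R F"
  using degree_class_closed[of _ 0] degree_class_add[of _ 0] degree_class_mult[of _ 0 _ 0]
  by (intro ring_hom_memI) (simp_all add: degree_class_0_one)

text \<open>
  The component of degree \<open>0\<close> is a copy of \<open>R/\<mm>\<close>.
\<close>

lemma subfield_residue_field: "subfield residue_field F"
proof -
  interpret F: ring F by (rule fiber_ring_is_ring)
  interpret h: ring_hom_ring R F "degree_class 0"
    by (rule ring_hom_ringI2[OF ring_axioms fiber_ring_is_ring degree_class_0_hom])
  have sub: "subring residue_field F" unfolding residue_field_eq by (rule h.img_is_subring[OF carrier_is_subring])
  have comm: "u \<otimes>\<^bsub>F\<^esub> v = v \<otimes>\<^bsub>F\<^esub> u" if uv: "u \<in> residue_field" "v \<in> residue_field" for u v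
  proof -
    obtain a b where "a \<in> carrier R" "b \<in> carrier R" "u = degree_class 0 a" "v = degree_class 0 b"
      using uv unfolding residue_field_eq by blast
    then show ?thesis using m_comm[of a b] h.hom_mult[of a b] h.hom_mult[of b a] by simp
  qed
  have one: "\<one>\<^bsub>F\<^esub> \<noteq> \<zero>\<^bsub>F\<^esub>"
  proof
    assume "\<one>\<^bsub>F\<^esub> = \<zero>\<^bsub>F\<^esub>"
    then have "\<one> \<ominus> \<zero> \<in> \<mm>"
      using degree_class_eq_iff[of \<one> \<zero> 0] by (simp only: degree_class_0_one degree_class_zero modulus_0) simp
    then show False
      using ideal.one_imp_carrier[OF ideal_maximal] maximalideal.I_notcarr[OF maximal]
      by (simp add: minus_eq)
  qed
  have "Units (F\<lparr>carrier := residue_field\<rparr>) = residue_field - {\<zero>\<^bsub>F\<^esub>}"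
  proof
    show "Units (F\<lparr>carrier := residue_field\<rparr>) \<subseteq> residue_field - {\<zero>\<^bsub>F\<^esub>}"
      using one subringE(1)[OF sub] by (auto simp: Units_def)
    show "residue_field - {\<zero>\<^bsub>F\<^esub>} \<subseteq> Units (F\<lparr>carrier := residue_field\<rparr>)"
    proof
      fix u assume u: "u \<in> residue_field - {\<zero>\<^bsub>F\<^esub>}"
      then obtain r where r: "r \<in> carrier R" "u = degree_class 0 r" unfolding residue_field_eq by auto
      have "r \<notin> \<mm>"
      proof
        assume "r \<in> \<mm>"
        then have "r \<ominus> \<zero> \<in> modulus 0" using r by (simp only: modulus_0) (simp add: minus_eq)
        then have "u = \<zero>\<^bsub>F\<^esub>" using degree_class_eq_iff[of r \<zero> 0] r by (simp add: degree_class_zero)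
        then show False using u by simp
      qed
      then obtain s where s: "s \<in> carrier R" "r \<otimes> s \<ominus> \<one> \<in> \<mm>"
        using invertible_mod_maximal r by blast
      then have "degree_class 0 (r \<otimes> s) = degree_class 0 \<one>"
        using degree_class_eq_iff[of "r \<otimes> s" \<one> 0] r by (simp only: modulus_0) simp
      then have "u \<otimes>\<^bsub>F\<^esub> degree_class 0 s = \<one>\<^bsub>F\<^esub>"
        using r s by (simp add: degree_class_0_one)
      moreover have sK: "degree_class 0 s \<in> residue_field" using s unfolding residue_field_eq by blast
      moreover have "degree_class 0 s \<otimes>\<^bsub>F\<^esub> u = \<one>\<^bsub>F\<^esub>"
        using calculation comm[of u "degree_class 0 s"] u by simp
      ultimately show "u \<in> Units (F\<lparr>carrier := residue_field\<rparr>)"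
        using u by (auto simp: Units_def)
    qed
  qed
  then show ?thesis
    by (intro F.subfieldI F.subcringI sub comm)
qed

text \<open>
  The residue field acts on the component of degree \<open>k\<close> through \<open>R\<close>, so that linear combinations of
  classes are classes of \<open>R\<close>-linear combinations.
\<close>

lemma Span_degree_class:
  assumes "set ts \<subseteq> I_pow k"
  shows "ring.Span F residue_field (map (degree_class k) ts) = degree_class k ` (Idl (set ts))"
proof -
  interpret F: ring F by (rule fiber_ring_is_ring)
  show ?thesis using assms
  proof (induction ts)
    case Nil
    have "Idl {} = {\<zero>}"
      using genideal_minimal[OF zeroideal, of "{}"]
        additive_subgroup.zero_closed[OF ideal.axioms(1)[OF genideal_ideal[of "{}"]]] by auto
    then show ?case by (simp add: degree_class_zero)
  next
    case (Cons t ts)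
    have t: "t \<in> I_pow k" and ts: "set ts \<subseteq> I_pow k" using Cons.prems by auto
    have sub: "Idl (set ts) \<subseteq> I_pow k" by (rule genideal_minimal[OF ideal_pow ts])
    have step: "degree_class 0 r \<otimes>\<^bsub>F\<^esub> degree_class k t \<oplus>\<^bsub>F\<^esub> degree_class k y = degree_class k (r \<otimes> t \<oplus> y)"
      if "r \<in> carrier R" "y \<in> Idl (set ts)" for r y
    proof -
      have "r \<otimes> t \<in> I_pow k" using ideal.I_l_closed[OF ideal_pow t that(1)] .
      moreover have "degree_class 0 r \<otimes>\<^bsub>F\<^esub> degree_class k t = degree_class k (r \<otimes> t)"
        using degree_class_mult[of r 0 t k] that t by (simp add: pow_0)
      ultimately show ?thesis using degree_class_add sub that by auto
    qed
    have "F.Span residue_field (map (degree_class k) (t # ts))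
        = F.line_extension residue_field (degree_class k t) (degree_class k ` (Idl (set ts)))"
      using Cons.IH[OF ts] by simp
    also have "\<dots> = {degree_class 0 r \<otimes>\<^bsub>F\<^esub> degree_class k t \<oplus>\<^bsub>F\<^esub> degree_class k y | r y.
        r \<in> carrier R \<and> y \<in> Idl (set ts)}"
      by (rule Set.set_eqI, unfold F.line_extension_mem_iff residue_field_eq) blast
    also have "\<dots> = {degree_class k (r \<otimes> t \<oplus> y) | r y. r \<in> carrier R \<and> y \<in> Idl (set ts)}"
      by (intro Collect_cong ex_cong1) (use step in auto)
    also have "\<dots> = degree_class k ` (Idl (set (t # ts)))"
    proof -
      have "Idl (set (t # ts)) = {r \<otimes> t \<oplus> y | r y. r \<in> carrier R \<and> y \<in> Idl (set ts)}"
        using genideal_insert[of t "set ts"] t ts pow_subset[of k] by auto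
      then show ?thesis by (simp only:) blast
    qed
    finally show ?case .
  qed
qed

lemma subset_genideal_add_modulus:
  assumes "T \<subseteq> I_pow k" "degree_class k ` (Idl T) = degree_class k ` I_pow k"
  shows "I_pow k \<subseteq> Idl T <+>\<^bsub>R\<^esub> modulus k"
proof
  fix x assume x: "x \<in> I_pow k"
  then obtain y where y: "y \<in> Idl T" "degree_class k x = degree_class k y"
    using assms(2) by (metis imageE imageI)
  have c: "x \<in> carrier R" "y \<in> carrier R"
    using x y genideal_minimal[OF ideal_pow assms(1)] pow_subset by auto
  have "x \<ominus> y \<in> modulus k" using y(2) c degree_class_eq_iff by blast
  moreover have "x = y \<oplus> (x \<ominus> y)" using c by algebra
  ultimately show "x \<in> Idl T <+>\<^bsub>R\<^esub> modulus k" using y(1) unfolding set_add_def' by blast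
qed

text \<open>
  Nakayama's lemma enters through the subsets of a single generating set \<open>S\<close>. In the graded case
  \<open>S\<close> will consist of homogeneous elements, whereas \<open>min_num_gens\<close> admits arbitrary generators;
  these are compared with \<open>S\<close> through the dimension.
\<close>

theorem fiber_hilbert_function_eq_min_num_gens:
  assumes S: "finite S" "S \<subseteq> carrier R" "Idl S = I_pow k"
    and nakayama: "\<And>T. T \<subseteq> S \<Longrightarrow> I_pow k \<subseteq> Idl T <+>\<^bsub>R\<^esub> modulus k \<Longrightarrow> I_pow k \<subseteq> Idl T"
  shows "fiber_hilbert_function R \<mm> I k = min_num_gens R (I_pow k)"
proof -
  interpret F: ring F by (rule fiber_ring_is_ring)
  let ?c = "degree_class k" and ?E = "fiber_component R \<mm> I k"
  have basis: "\<exists>ys. set ys \<subseteq> T \<and> length ys \<le> card T \<and> F.independent residue_field (map ?c ys)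
      \<and> F.Span residue_field (map ?c ys) = ?E"
    if T: "finite T" "T \<subseteq> carrier R" "Idl T = I_pow k" for T
  proof -
    obtain xs where xs: "set xs = T" "length xs = card T"
      using T(1) finite_distinct_list distinct_card by metis
    have TI: "T \<subseteq> I_pow k" using genideal_self[OF T(2)] T(3) by simp
    obtain ys where ys: "set ys \<subseteq> set xs" "length ys \<le> length xs"
      "F.independent residue_field (map ?c ys)" "F.Span residue_field (map ?c ys) = F.Span residue_field (map ?c xs)"
      using F.independent_subfamily[OF subfield_residue_field, of ?c xs] degree_class_closed TI xs by blast
    moreover have "F.Span residue_field (map ?c xs) = ?E"
      using Span_degree_class[of xs k] TI xs T(3) by (simp add: fiber_component_eq)
    ultimately show ?thesis using xs by metis
  qed
  \<comment> \<open>Generators from \<open>S\<close> whose classes form a basis; they are a minimal generating set.\<close>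
  obtain ys where ys: "set ys \<subseteq> S" "F.independent residue_field (map ?c ys)" "F.Span residue_field (map ?c ys) = ?E"
    using basis[OF S] by blast
  have dim: "F.dimension (length ys) residue_field ?E"
    using F.dimensionI[OF subfield_residue_field ys(2,3)] by simp
  then have hf: "fiber_hilbert_function R \<mm> I k = length ys"
    unfolding fiber_hilbert_function_def F.dim_def
    using F.dimension_is_inj[OF subfield_residue_field] by (intro the_equality)
  have SI: "S \<subseteq> I_pow k" using genideal_self[OF S(2)] S(3) by simp
  have "I_pow k \<subseteq> Idl (set ys) <+>\<^bsub>R\<^esub> modulus k"
    using ys SI Span_degree_class[of ys k] by (intro subset_genideal_add_modulus) (auto simp: fiber_component_eq)
  then have gen: "Idl (set ys) = I_pow k"
    using nakayama[OF ys(1)] genideal_minimal[OF ideal_pow, of "set ys" k] ys(1) SI by blast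
  have "min_num_gens R (I_pow k) = length ys"
    unfolding min_num_gens_def
  proof (rule Least_equality)
    have "distinct ys" using F.independent_distinct[OF subfield_residue_field ys(2)] by (simp add: distinct_map)
    then have "card (set ys) = length ys" by (rule distinct_card)
    then show "\<exists>T. T \<subseteq> carrier R \<and> finite T \<and> card T = length ys \<and> Idl T = I_pow k"
      using gen ys(1) S(2) by (intro exI[of _ "set ys"]) auto
  next
    fix n assume "\<exists>T. T \<subseteq> carrier R \<and> finite T \<and> card T = n \<and> Idl T = I_pow k"
    then obtain T where T: "finite T" "T \<subseteq> carrier R" "Idl T = I_pow k" "card T = n" by blast
    obtain zs where zs: "length zs \<le> n" "F.independent residue_field (map ?c zs)" "F.Span residue_field (map ?c zs) = ?E"
      using basis[OF T(1-3)] T(4) by blast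
    have "length ys = length zs"
      using F.dimension_is_inj[OF subfield_residue_field dim] F.dimensionI[OF subfield_residue_field zs(2,3)] by simp
    then show "length ys \<le> n" using zs by simp
  qed
  then show ?thesis using hf by simp
qed

lemma fiber_hilbert_function_0: "fiber_hilbert_function R \<mm> I 0 = 1"
proof -
  interpret F: ring F by (rule fiber_ring_is_ring)
  show ?thesis
    unfolding fiber_hilbert_function_def F.dim_def
    using F.dimension_one[OF subfield_residue_field] F.dimension_is_inj[OF subfield_residue_field]
    by (intro the_equality)
qed

end

section \<open>Hilbert function and numbers of generators\<close>

theorem (in noetherian_local_ring) fiber_hilbert_function_local:
  assumes I: "ideal I R"
  shows "fiber_hilbert_function R \<mm> I k = min_num_gens R (ideal_pow R I k)"
proof -
  interpret fiber_data R \<mm> I 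
    by (rule fiber_data.intro[OF cring_axioms fiber_data_axioms.intro[OF maximal I]])
  obtain S where S: "S \<subseteq> carrier R" "finite S" "ideal_pow R I k = Idl S"
    using finetely_gen[OF ideal_pow] by blast
  show ?thesis
  proof (rule fiber_hilbert_function_eq_min_num_gens[OF S(2,1) S(3)[symmetric]])
    fix T assume T: "T \<subseteq> S" "I_pow k \<subseteq> Idl T <+>\<^bsub>R\<^esub> modulus k"
    have "ideal (Idl T) R" using T(1) S(1) by (intro genideal_ideal) auto
    then show "I_pow k \<subseteq> Idl T" using nakayama_local[OF S(2,1)] T(2) unfolding S(3) by blast
  qed
qed

theorem (in standard_graded_algebra) fiber_hilbert_function_graded:
  assumes I: "graded_ideal R A I"
  shows "fiber_hilbert_function R (graded_maximal_ideal R A) I k = min_num_gens R (ideal_pow R I k)"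
proof -
  have "ideal I R" using I by (simp add: graded_ideal_def)
  then interpret fiber_data R "graded_maximal_ideal R A" I
    by (intro fiber_data.intro[OF cring_axioms]
        fiber_data_axioms.intro[OF maximalideal_graded_maximal_ideal])
  obtain S where S: "finite S" "S \<subseteq> (\<Union>i. A i)" "Idl S = I"
    using homogeneous_generators[OF I] by blast
  obtain T where T: "finite T" "T \<subseteq> (\<Union>i. A i)" "Idl T = ideal_pow R I k"
    using homogeneous_generators_pow[OF S(1,2), of k] unfolding S(3) by blast
  have Tc: "T \<subseteq> carrier R" using T(2) A_carrier by blast
  show ?thesis
  proof (rule fiber_hilbert_function_eq_min_num_gens[OF T(1) Tc T(3)])
    fix U assume U: "U \<subseteq> T" "I_pow k \<subseteq> Idl U <+>\<^bsub>R\<^esub> modulus k"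
    have "U \<subseteq> (\<Union>i. A i)" using U(1) T(2) by blast
    then show "I_pow k \<subseteq> Idl U" using nakayama_graded[OF T(1,2)] U(2) unfolding T(3)[symmetric] by blast
  qed
qed

section \<open>The second entry of the h-vector\<close>

lemma one_minus_X_power_coeffs:
  fixes l :: nat
  defines "P \<equiv> (1 - fps_X :: int fps) ^ l"
  shows "fps_nth P 0 = 1" "fps_nth P 1 = - int l" "fps_nth P 2 = int (l choose 2)"
proof -
  have "fps_nth ((1 - fps_X :: int fps) ^ l) 0 = 1 \<and> fps_nth ((1 - fps_X :: int fps) ^ l) 1 = - int l
    \<and> fps_nth ((1 - fps_X :: int fps) ^ l) 2 = int (l choose 2)"
  proof (induction l)
    case (Suc l)
    have "Suc l choose 2 = l + (l choose 2)"
      by (simp add: numeral_2_eq_2)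
    then show ?case using Suc by (simp add: left_diff_distrib numeral_2_eq_2)
  qed simp
  then show "fps_nth P 0 = 1" "fps_nth P 1 = - int l" "fps_nth P 2 = int (l choose 2)"
    by (simp_all add: P_def)
qed

lemma h_vector_2:
  "h_vector R \<mm> I 2 = int (fiber_hilbert_function R \<mm> I 2)
    - int (analytic_spread R \<mm> I) * int (fiber_hilbert_function R \<mm> I 1)
    + int (analytic_spread R \<mm> I choose 2) * int (fiber_hilbert_function R \<mm> I 0)"
proof -
  have set: "{0..2::nat} = {0, 1, 2}" by auto
  show ?thesis
    unfolding h_vector_def fps_mult_nth set
    using one_minus_X_power_coeffs[of "analytic_spread R \<mm> I"]
    by (simp add: fiber_hilbert_series_def)
qed

theorem proposition2p5:
  fixes R :: "('a, 'b) ring_scheme" and \<mm> I :: "'a set"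
  assumes "noetherian_local_ring R \<mm> \<or>
      (\<exists>A. standard_graded_algebra R A \<and> \<mm> = graded_maximal_ideal R A \<and> graded_ideal R A I)"
    and "ideal I R" and "I \<noteq> carrier R"
  shows "int (min_num_gens R (ideal_pow R I 2)) =
    int (analytic_spread R \<mm> I) * int (min_num_gens R I)
      - int (analytic_spread R \<mm> I choose 2) + h_vector R \<mm> I 2"
proof -
  have "fiber_data R \<mm> I \<and>
    (\<forall>k. fiber_hilbert_function R \<mm> I k = min_num_gens R (ideal_pow R I k))"
    using assms(1)
  proof
    assume "noetherian_local_ring R \<mm>"
    then interpret noetherian_local_ring R \<mm> .
    show ?thesis
      using fiber_hilbert_function_local[OF assms(2)]
        fiber_data.intro[OF cring_axioms fiber_data_axioms.intro[OF maximal assms(2)]] by blast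
  next
    assume "\<exists>A. standard_graded_algebra R A \<and> \<mm> = graded_maximal_ideal R A \<and> graded_ideal R A I"
    then obtain A where A: "standard_graded_algebra R A" and \<mm>: "\<mm> = graded_maximal_ideal R A"
      and I: "graded_ideal R A I" by blast
    interpret standard_graded_algebra R A by (rule A)
    show ?thesis
      using fiber_hilbert_function_graded[OF I] fiber_data.intro[OF cring_axioms
          fiber_data_axioms.intro[OF maximalideal_graded_maximal_ideal assms(2)]]
      unfolding \<mm> by blast
  qed
  then have data: "fiber_data R \<mm> I"
    and hilb: "fiber_hilbert_function R \<mm> I k = min_num_gens R (ideal_pow R I k)" for k by auto
  interpret fiber_data R \<mm> I by (rule data)
  have "ideal_pow R I 1 = I" by (rule pow_1)
  then have "fiber_hilbert_function R \<mm> I 1 = min_num_gens R I" using hilb[of 1] by simp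
  then show ?thesis
    using h_vector_2[of R \<mm> I] hilb[of 2] fiber_hilbert_function_0 by simp
qed

end
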